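(* Every element of the Jacobson radical $\mathrm{Rad}(\mathbb{T})$ lies in $\mathbb{I}$; in fact $\mathrm{Rad}(\mathbb{T})=\mathbb{I}$, where $\mathbb{I}$ is the $\mathbb{F}$-span of $\{B_{\mathbf a,\mathbf b,\mathbf c}:(\mathbf a,\mathbf b,\mathbf c)\in\mathbb{P},\ p\mid k_{\mathbf b}\}$. Moreover, the nilpotent index of $\mathrm{Rad}(\mathbb{T})$ equals $2\,|\{a\in\{1,\dots,n\}: p\mid |U_a|-1\}|+1$.
   Context: Let $\mathbb{F}$ be a field of characteristic $p\ge 0$; for a positive integer $m$, "$p\mid m$" means that the image of $m$ in $\mathbb{F}$ is zero. Let $n\ge 1$ and let $U_1,\dots,U_n$ be finite sets with $|U_h|\ge 2$. Put $X=U_1\times\cdots\times U_n$ and $E=\{0,1\}^n$. For $\mathbf g\in E$ let $S(\mathbf g)=\{a:\mathbf g_a=1\}$. For $V\subseteq\{1,\dots,n\}$ let $V^\circ=\{a\in V:|U_a|>2\}$. Let $R_{\mathbf g}=\{(\mathbf y,\mathbf z)\in X\times X:\ \mathbf y_a\neq\mathbf z_a\iff\mathbf g_a=1\}$ and $k_{\mathbf g}=\prod_{a\in S(\mathbf g)}(|U_a|-1)$ ($k_{\mathbf 0}=1$). Let $A_{\mathbf g}\in\mathrm{M}_X(\mathbb{F})$ be the $\{0,1\}$ adjacency matrix of $R_{\mathbf g}$. Fix $\mathbf x\in X$ and let $E^*_{\mathbf g}$ be the diagonal matrix with $(\mathbf y,\mathbf y)$-entry $1$ iff $(\mathbf x,\mathbf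 y)\in R_{\mathbf g}$, else $0$. $\mathbb{T}$ is the $\mathbb{F}$-subalgebra of $\mathrm{M}_X(\mathbb{F})$ generated by all $A_{\mathbf g},E^*_{\mathbf g}$. Let $\mathbb{P}$ be the set of $(\mathbf a,\mathbf b,\mathbf c)\in E^3$ with $S(\mathbf a)\triangle S(\mathbf c)\subseteq S(\mathbf b)\subseteq(S(\mathbf a)\triangle S(\mathbf c))\cup(S(\mathbf a)\cap S(\mathbf c))^\circ$. For $(\mathbf g,\mathbf h,\mathbf i)\in\mathbb{P}$ let $B_{\mathbf g,\mathbf h,\mathbf i}=\sum_{\mathbf j}E^*_{\mathbf g}A_{\mathbf j}E^*_{\mathbf i}$ over all $\mathbf j\in E$ with $S(\mathbf g)\triangle S(\mathbf i)\subseteq S(\mathbf j)\subseteq S(\mathbf h)$. The nilpotent index of a nilpotent ideal is the least $m\ge1$ such that every product of $m$ of its elements is zero. *)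

theory Defs
  imports
    "HOL-Library.FuncSet"
    "HOL-Algebra.Module"
    "HOL-Algebra.Ideal"
    "HOL-Algebra.Subrings"
    "HOL-Algebra.Algebraic_Closure_Type"
begin

section \<open>Rings, algebras and radicals\<close>

definition lin_span :: "('f, 'r) ring_scheme \<Rightarrow> ('f, 'm, 's) module_scheme \<Rightarrow> 'm set \<Rightarrow> 'm set"
  where "lin_span F M S =
    {\<Oplus>\<^bsub>M\<^esub>v\<in>A. c v \<odot>\<^bsub>M\<^esub> v | A c. finite A \<and> A \<subseteq> S \<and> c \<in> A \<rightarrow> carrier F}"

text \<open>The ambient algebra is not required to be commutative, unlike in the library's
  locale \<^locale>\<open>algebra\<close>.\<close>

definition gen_subalgebra :: "('f, 'r) ring_scheme \<Rightarrow> ('f, 'm, 's) module_scheme \<Rightarrow> 'm set \<Rightarrow> 'm set"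
  where "gen_subalgebra F M S = \<Inter> {H. subring H M \<and> submodule H F M \<and> S \<subseteq> H}"

definition left_ideal :: "'a set \<Rightarrow> ('a, 'b) ring_scheme \<Rightarrow> bool"
  where "left_ideal I R \<longleftrightarrow>
    additive_subgroup I R \<and> (\<forall>a\<in>I. \<forall>x\<in>carrier R. x \<otimes>\<^bsub>R\<^esub> a \<in> I)"

definition maximal_left_ideal :: "'a set \<Rightarrow> ('a, 'b) ring_scheme \<Rightarrow> bool"
  where "maximal_left_ideal I R \<longleftrightarrow>
    left_ideal I R \<and> I \<noteq> carrier R \<and>
    (\<forall>J. left_ideal J R \<and> I \<subseteq> J \<longrightarrow> J = I \<or> J = carrier R)"

definition jacobson_radical :: "('a, 'b) ring_scheme \<Rightarrow> 'a set"
  where "jacobson_radical R = {x \<in> carrier R. \<forall>I. maximal_left_ideal I R \<longrightarrow> x \<in> I}"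

definition products_vanish :: "('a, 'b) ring_scheme \<Rightarrow> 'a set \<Rightarrow> nat \<Rightarrow> bool"
  where "products_vanish R I m \<longleftrightarrow>
    (\<forall>xs. length xs = m \<and> set xs \<subseteq> I \<longrightarrow> foldr (\<otimes>\<^bsub>R\<^esub>) xs \<one>\<^bsub>R\<^esub> = \<zero>\<^bsub>R\<^esub>)"

definition nilpotent_ideal :: "'a set \<Rightarrow> ('a, 'b) ring_scheme \<Rightarrow> bool"
  where "nilpotent_ideal I R \<longleftrightarrow> ideal I R \<and> (\<exists>m\<ge>1. products_vanish R I m)"

text \<open>Only meaningful for a nilpotent ideal.\<close>

definition nilpotent_index :: "'a set \<Rightarrow> ('a, 'b) ring_scheme \<Rightarrow> nat"
  where "nilpotent_index I R = (LEAST m. m \<ge> 1 \<and> products_vanish R I m)"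


section \<open>Matrices indexed by a finite set\<close>

text \<open>A matrix with rows and columns indexed by \<open>Y\<close> is a function of two arguments that is
  zero outside \<open>Y \<times> Y\<close>.\<close>

definition matrix_algebra :: "'x set \<Rightarrow> ('f::field, 'x \<Rightarrow> 'x \<Rightarrow> 'f) module"
  where "matrix_algebra Y =
    \<lparr>carrier = {M. \<forall>y z. y \<notin> Y \<or> z \<notin> Y \<longrightarrow> M y z = 0},
     monoid.mult = (\<lambda>M N y z. \<Sum>w\<in>Y. M y w * N w z),
     monoid.one = (\<lambda>y z. if y \<in> Y \<and> y = z then 1 else 0),
     ring.zero = (\<lambda>y z. 0),
     ring.add = (\<lambda>M N y z. M y z + N y z),
     module.smult = (\<lambda>c M y z. c * M y z)\<rparr>"

lemma ring_matrix_algebra: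
  assumes "finite Y"
  shows "ring (matrix_algebra Y :: ('f::field, 'x \<Rightarrow> 'x \<Rightarrow> 'f) module)"
proof (rule ringI)
  show "abelian_group (matrix_algebra Y :: ('f, 'x \<Rightarrow> 'x \<Rightarrow> 'f) module)"
  proof (rule abelian_groupI)
    fix M :: "'x \<Rightarrow> 'x \<Rightarrow> 'f"
    assume "M \<in> carrier (matrix_algebra Y)"
    then show "\<exists>N\<in>carrier (matrix_algebra Y).
        N \<oplus>\<^bsub>matrix_algebra Y\<^esub> M = \<zero>\<^bsub>matrix_algebra Y\<^esub>"
      by (intro bexI[of _ "\<lambda>y z. - M y z"]) (auto simp: matrix_algebra_def)
  qed (auto simp: matrix_algebra_def algebra_simps)
  show "Group.monoid (matrix_algebra Y :: ('f, 'x \<Rightarrow> 'x \<Rightarrow> 'f) module)"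
  proof (rule monoidI)
    fix M N K :: "'x \<Rightarrow> 'x \<Rightarrow> 'f"
    have "(\<Sum>w\<in>Y. (\<Sum>v\<in>Y. M y v * N v w) * K w z) =
        (\<Sum>v\<in>Y. M y v * (\<Sum>w\<in>Y. N v w * K w z))" for y z
      by (simp add: sum_distrib_left sum_distrib_right mult.assoc)
        (rule sum.swap)
    then show "M \<otimes>\<^bsub>matrix_algebra Y\<^esub> N \<otimes>\<^bsub>matrix_algebra Y\<^esub> K =
        M \<otimes>\<^bsub>matrix_algebra Y\<^esub> (N \<otimes>\<^bsub>matrix_algebra Y\<^esub> K)"
      by (simp add: matrix_algebra_def)
  next
    fix M :: "'x \<Rightarrow> 'x \<Rightarrow> 'f"
    assume M: "M \<in> carrier (matrix_algebra Y)"
    have "(\<Sum>w\<in>Y. (if y \<in> Y \<and> y = w then 1 else 0) * M w z) = M y z" for y z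
      using M assms
      by (cases "y \<in> Y") (auto simp: matrix_algebra_def if_distrib[of "\<lambda>c. c * _"] cong: if_cong)
    then show "\<one>\<^bsub>matrix_algebra Y\<^esub> \<otimes>\<^bsub>matrix_algebra Y\<^esub> M = M"
      by (simp add: matrix_algebra_def)
    have "(\<Sum>w\<in>Y. M y w * (if w \<in> Y \<and> w = z then 1 else 0)) = M y z" for y z
    proof -
      have "(\<Sum>w\<in>Y. M y w * (if w \<in> Y \<and> w = z then 1 else 0)) =
          (\<Sum>w\<in>Y. if w = z then M y w else 0)"
        by (rule sum.cong) auto
      then show ?thesis
        using M assms by (auto simp: matrix_algebra_def)
    qed
    then show "M \<otimes>\<^bsub>matrix_algebra Y\<^esub> \<one>\<^bsub>matrix_algebra Y\<^esub> = M"
      by (simp add: matrix_algebra_def)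
  qed (auto simp: matrix_algebra_def)
qed (auto simp: matrix_algebra_def algebra_simps sum.distrib)

lemma module_matrix_algebra:
  assumes "finite Y"
  shows "module ring_of_type_algebra (matrix_algebra Y :: ('f::field, 'x \<Rightarrow> 'x \<Rightarrow> 'f) module)"
proof (rule moduleI)
  show "cring (ring_of_type_algebra :: 'f ring)" ..
  show "abelian_group (matrix_algebra Y :: ('f, 'x \<Rightarrow> 'x \<Rightarrow> 'f) module)"
    using ring_matrix_algebra[OF assms] by (rule ring.is_abelian_group)
qed (auto simp: matrix_algebra_def ring_of_type_algebra_def algebra_simps)


section \<open>The factorial scheme and its Terwilliger algebra\<close>

definition points :: "nat \<Rightarrow> (nat \<Rightarrow> 'u set) \<Rightarrow> (nat \<Rightarrow> 'u) set"
  where "points n U = (\<Pi>\<^sub>E a\<in>{1..n}. U a)"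

definition bit_vectors :: "nat \<Rightarrow> (nat \<Rightarrow> nat) set"
  where "bit_vectors n = (\<Pi>\<^sub>E a\<in>{1..n}. {0, 1})"

definition supp :: "nat \<Rightarrow> (nat \<Rightarrow> nat) \<Rightarrow> nat set"
  where "supp n g = {a \<in> {1..n}. g a = 1}"

definition big_part :: "(nat \<Rightarrow> 'u set) \<Rightarrow> nat set \<Rightarrow> nat set"
  where "big_part U V = {a \<in> V. card (U a) > 2}"

definition scheme_rel :: "nat \<Rightarrow> (nat \<Rightarrow> 'u set) \<Rightarrow> (nat \<Rightarrow> nat) \<Rightarrow> ((nat \<Rightarrow> 'u) \<times> (nat \<Rightarrow> 'u)) set"
  where "scheme_rel n U g =
    {(y, z) \<in> points n U \<times> points n U. \<forall>a\<in>{1..n}. y a \<noteq> z a \<longleftrightarrow> g a = 1}"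

definition valency :: "nat \<Rightarrow> (nat \<Rightarrow> 'u set) \<Rightarrow> (nat \<Rightarrow> nat) \<Rightarrow> nat"
  where "valency n U g = (\<Prod>a\<in>supp n g. card (U a) - 1)"

definition adj_mat ::
    "nat \<Rightarrow> (nat \<Rightarrow> 'u set) \<Rightarrow> (nat \<Rightarrow> nat) \<Rightarrow> (nat \<Rightarrow> 'u) \<Rightarrow> (nat \<Rightarrow> 'u) \<Rightarrow> 'f::field"
  where "adj_mat n U g = (\<lambda>y z. if (y, z) \<in> scheme_rel n U g then 1 else 0)"

definition dual_idem ::
    "nat \<Rightarrow> (nat \<Rightarrow> 'u set) \<Rightarrow> (nat \<Rightarrow> 'u) \<Rightarrow> (nat \<Rightarrow> nat) \<Rightarrow> (nat \<Rightarrow> 'u) \<Rightarrow> (nat \<Rightarrow> 'u) \<Rightarrow> 'f::field"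
  where "dual_idem n U x g = (\<lambda>y z. if y = z \<and> (x, y) \<in> scheme_rel n U g then 1 else 0)"

definition terwilliger_algebra ::
    "nat \<Rightarrow> (nat \<Rightarrow> 'u set) \<Rightarrow> (nat \<Rightarrow> 'u) \<Rightarrow> ('f::field, (nat \<Rightarrow> 'u) \<Rightarrow> (nat \<Rightarrow> 'u) \<Rightarrow> 'f) module"
  where "terwilliger_algebra n U x =
    (matrix_algebra (points n U))
      \<lparr>carrier := gen_subalgebra ring_of_type_algebra (matrix_algebra (points n U))
        (adj_mat n U ` bit_vectors n \<union> dual_idem n U x ` bit_vectors n)\<rparr>"

definition triples :: "nat \<Rightarrow> (nat \<Rightarrow> 'u set) \<Rightarrow> ((nat \<Rightarrow> nat) \<times> (nat \<Rightarrow> nat) \<times> (nat \<Rightarrow> nat)) set"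
  where "triples n U =
    {(a, b, c) \<in> bit_vectors n \<times> bit_vectors n \<times> bit_vectors n.
      sym_diff (supp n a) (supp n c) \<subseteq> supp n b \<and>
      supp n b \<subseteq> sym_diff (supp n a) (supp n c) \<union> big_part U (supp n a \<inter> supp n c)}"

definition B_mat ::
    "nat \<Rightarrow> (nat \<Rightarrow> 'u set) \<Rightarrow> (nat \<Rightarrow> 'u) \<Rightarrow> (nat \<Rightarrow> nat) \<Rightarrow> (nat \<Rightarrow> nat) \<Rightarrow> (nat \<Rightarrow> nat) \<Rightarrow>
      (nat \<Rightarrow> 'u) \<Rightarrow> (nat \<Rightarrow> 'u) \<Rightarrow> 'f::field"
  where "B_mat n U x g h i =
    (\<Oplus>\<^bsub>matrix_algebra (points n U)\<^esub>
      j \<in> {j \<in> bit_vectors n. sym_diff (supp n g) (supp n i) \<subseteq> supp n j \<and> supp n j \<subseteq> supp n h}.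
      dual_idem n U x g \<otimes>\<^bsub>matrix_algebra (points n U)\<^esub> adj_mat n U j
        \<otimes>\<^bsub>matrix_algebra (points n U)\<^esub> dual_idem n U x i)"

text \<open>The condition \<open>p \<bar> m\<close>, for \<open>p\<close> the characteristic of the field, is expressed as
  \<open>of_nat m = 0\<close> in the field.\<close>

definition radical_span ::
    "nat \<Rightarrow> (nat \<Rightarrow> 'u set) \<Rightarrow> (nat \<Rightarrow> 'u) \<Rightarrow> ((nat \<Rightarrow> 'u) \<Rightarrow> (nat \<Rightarrow> 'u) \<Rightarrow> 'f::field) set"
  where "radical_span n U x =
    lin_span ring_of_type_algebra (matrix_algebra (points n U))
      {B_mat n U x a b c | a b c. (a, b, c) \<in> triples n U \<and> of_nat (valency n U b) = (0::'f)}"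

end

theory Submission
  imports Defs
begin

text \<open>
  Every \<open>B\<^sub>g\<^sub>h\<^sub>i\<close> is a tensor product over the coordinates of \<open>0/1\<close> matrices of five kinds: with
  respect to the splitting of \<open>U\<^sub>a\<close> into \<open>{x\<^sub>a}\<close> and its complement, the unit \<open>e\<close> at \<open>x\<^sub>a\<close>, the all-ones row
  \<open>R\<close> and column \<open>C\<close>, and the identity \<open>I\<close> and all-ones block \<open>J\<close> on the complement. Put
  \<open>m = |U\<^sub>a| - 1\<close>. Then \<open>CR = J\<close>, while \<open>RC\<close>, \<open>RJ\<close>, \<open>JC\<close> and \<open>JJ\<close> carry a factor \<open>m\<close>. Giving the
  kinds \<open>e, I, R, C, J\<close> the degrees \<open>0, 0, 1, 1, 2\<close> at the coordinates with \<open>m = 0\<close> in the field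
  makes the algebra filtered, with largest degree twice the number \<open>d\<close> of such coordinates. The span of
  positive degree is the span in the theorem; it is an ideal with vanishing
  \<open>(2d + 1)\<close>-fold products, and the product of all \<open>CR\<close> shows that \<open>2d\<close> factors do not suffice.

  Conversely, at the coordinates with \<open>m \<noteq> 0\<close> the matrices \<open>e, R, C/m, J/m\<close> are matrix units
  and \<open>I - J/m\<close> is an idempotent orthogonal to them. If a radical element has a nonzero coefficient
  at a product of such matrices of degree zero, multiplying by suitable elements on both sides yields a
  nonzero idempotent modulo the nilpotent ideal, which is impossible.
\<close>

section \<open>The Jacobson radical and nilpotent ideals\<close>

context ring begin

text \<open>This is the left ideal generated by \<open>I\<close> and \<open>u\<close>. It serves
  twice: with \<open>I = {\<zero>}\<close> as the principal left ideal of \<open>u\<close>, and with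
  \<open>I\<close> maximal and \<open>u\<close> outside it, where it must be the whole ring.\<close>

lemma left_ideal_translates:
  assumes "left_ideal I R" "u \<in> carrier R"
  shows "left_ideal {m \<oplus> r \<otimes> u | m r. m \<in> I \<and> r \<in> carrier R} R"
proof -
  interpret I: additive_subgroup I R
    using assms(1) by (simp add: left_ideal_def)
  have I: "m \<in> carrier R" if "m \<in> I" for m
    using that I.a_subset by blast
  have Imul: "r \<otimes> m \<in> I" if "m \<in> I" "r \<in> carrier R" for m r
    using that assms(1) by (auto simp: left_ideal_def)
  let ?J = "{m \<oplus> r \<otimes> u | m r. m \<in> I \<and> r \<in> carrier R}"
  have "additive_subgroup ?J R"
  proof (intro additive_subgroupI add.subgroupI)
    show "?J \<subseteq> carrier R" using I assms by auto
    show "?J \<noteq> {}" using I.zero_closed by blast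
  next
    fix a assume "a \<in> ?J"
    then obtain m r where *: "a = m \<oplus> r \<otimes> u" "m \<in> I" "r \<in> carrier R" by auto
    have "\<ominus> a = (\<ominus> m) \<oplus> (\<ominus> r) \<otimes> u"
      using * I assms by (simp add: minus_add l_minus)
    moreover have "\<ominus> m \<in> I" using * I.a_inv_closed by blast
    ultimately show "\<ominus> a \<in> ?J" using * by blast
  next
    fix a b assume "a \<in> ?J" "b \<in> ?J"
    then obtain m r m' r' where *: "a = m \<oplus> r \<otimes> u" "m \<in> I" "r \<in> carrier R"
       "b = m' \<oplus> r' \<otimes> u" "m' \<in> I" "r' \<in> carrier R" by auto
    have "a \<oplus> b = (m \<oplus> m') \<oplus> (r \<oplus> r') \<otimes> u"
      using * I assms by (simp add: l_distr a_ac)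
    then show "a \<oplus> b \<in> ?J" using * I.a_closed by blast
  qed
  moreover have "s \<otimes> a \<in> ?J" if "a \<in> ?J" "s \<in> carrier R" for a s
  proof -
    from that obtain m r where *: "a = m \<oplus> r \<otimes> u" "m \<in> I" "r \<in> carrier R" by auto
    have "s \<otimes> a = s \<otimes> m \<oplus> (s \<otimes> r) \<otimes> u"
      using * that I assms by (simp add: r_distr m_assoc)
    then show ?thesis using * that Imul by blast
  qed
  ultimately show ?thesis by (simp add: left_ideal_def)
qed

lemma left_ideal_zero: "left_ideal {\<zero>} R"
  using zeroideal by (auto simp: left_ideal_def ideal_def)

text \<open>Zorn's lemma for the left ideals that contain \<open>L\<close> and miss the unit. A left
  ideal containing the unit is the whole ring, so a maximal member of this family is maximal among
  all proper left ideals.\<close>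

lemma proper_left_ideal_le_maximal:
  assumes L: "left_ideal L R" "\<one> \<notin> L"
  obtains I where "maximal_left_ideal I R" "L \<subseteq> I"
proof -
  let ?P = "{J. left_ideal J R \<and> L \<subseteq> J \<and> \<one> \<notin> J}"
  have "\<exists>M\<in>?P. \<forall>V\<in>?P. M \<subseteq> V \<longrightarrow> V = M"
  proof (rule subset_Zorn_nonempty)
    show "?P \<noteq> {}" using L by blast
    fix C assume C: "C \<noteq> {}" "subset.chain ?P C"
    then have CP: "C \<subseteq> ?P" and tot: "\<And>V W. V \<in> C \<Longrightarrow> W \<in> C \<Longrightarrow> V \<subseteq> W \<or> W \<subseteq> V"
      by (auto simp: subset_chain_def)
    have ag: "subgroup J (add_monoid R)" if "J \<in> C" for J
      using that CP by (auto simp: left_ideal_def additive_subgroup_def)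
    have "subgroup (\<Union>C) (add_monoid R)"
    proof (intro add.subgroupI)
      show "\<Union>C \<subseteq> carrier R" using ag by (fastforce dest: subgroup.subset)
      obtain J where "J \<in> C" using C by blast
      then have "\<zero> \<in> J" using subgroup.one_closed[OF ag] by auto
      then show "\<Union>C \<noteq> {}" using \<open>J \<in> C\<close> by blast
    next
      fix a assume "a \<in> \<Union>C"
      then show "\<ominus> a \<in> \<Union>C"
        using subgroup.m_inv_closed[OF ag] by (fastforce simp: a_inv_def)
    next
      fix a b assume "a \<in> \<Union>C" "b \<in> \<Union>C"
      then obtain V W where "V \<in> C" "W \<in> C" "a \<in> V" "b \<in> W" by blast
      with tot obtain Z where "Z \<in> C" "a \<in> Z" "b \<in> Z" by blast
      then show "a \<oplus> b \<in> \<Union>C" using subgroup.m_closed[OF ag] by auto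
    qed
    moreover have "r \<otimes> a \<in> \<Union>C" if ar: "a \<in> \<Union>C" "r \<in> carrier R" for a r
    proof -
      obtain J where "J \<in> C" "a \<in> J" using ar by blast
      moreover from this have "r \<otimes> a \<in> J" using CP ar by (auto simp: left_ideal_def)
      ultimately show ?thesis by blast
    qed
    ultimately have "left_ideal (\<Union>C) R"
      unfolding left_ideal_def additive_subgroup_def by blast
    moreover have "L \<subseteq> \<Union>C" "\<one> \<notin> \<Union>C" using C CP by auto
    ultimately show "\<Union>C \<in> ?P" by blast
  qed
  then obtain M where M: "M \<in> ?P" and mx: "\<forall>V\<in>?P. M \<subseteq> V \<longrightarrow> V = M" by (elim bexE)
  have "J = M \<or> J = carrier R" if J: "left_ideal J R" "M \<subseteq> J" for J
  proof (cases "\<one> \<in> J")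
    case True
    have "a \<in> J" if "a \<in> carrier R" for a
    proof -
      have "a \<otimes> \<one> \<in> J" using J(1) True that by (auto simp: left_ideal_def)
      then show ?thesis using that by simp
    qed
    moreover have "J \<subseteq> carrier R"
      using J(1) additive_subgroup.a_subset by (auto simp: left_ideal_def)
    ultimately show ?thesis by blast
  next
    case False
    then show ?thesis using bspec[OF mx, of J] J M by auto
  qed
  then have "maximal_left_ideal M R" using M by (auto simp: maximal_left_ideal_def)
  then show thesis using that M by blast
qed

text \<open>If the principal left ideal of \<open>\<one> \<ominus> a \<otimes> y\<close> missed
  \<open>\<one>\<close>, it would lie in a maximal left ideal. That ideal also contains
  \<open>y\<close>, hence \<open>a \<otimes> y\<close>, hence \<open>\<one>\<close>.\<close>

lemma jacobson_radical_left_inverse: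
  assumes y: "y \<in> jacobson_radical R" and a: "a \<in> carrier R"
  obtains w where "w \<in> carrier R" "w \<otimes> (\<one> \<ominus> a \<otimes> y) = \<one>"
proof -
  have yc: "y \<in> carrier R" using y by (simp add: jacobson_radical_def)
  let ?u = "\<one> \<ominus> a \<otimes> y"
  have uc: "?u \<in> carrier R" using yc a by simp
  let ?L = "{m \<oplus> r \<otimes> ?u | m r. m \<in> {\<zero>} \<and> r \<in> carrier R}"
  have L: "left_ideal ?L R" by (rule left_ideal_translates[OF left_ideal_zero uc])
  have "\<one> \<in> ?L"
  proof (rule ccontr)
    assume "\<one> \<notin> ?L"
    then obtain I where I: "maximal_left_ideal I R" "?L \<subseteq> I"
      using proper_left_ideal_le_maximal[OF L] by blast
    then have li: "left_ideal I R" and ne: "I \<noteq> carrier R"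
      by (auto simp: maximal_left_ideal_def)
    then interpret I: additive_subgroup I R by (simp add: left_ideal_def)
    have mul: "r \<otimes> m \<in> I" if "m \<in> I" "r \<in> carrier R" for m r
      using that li by (auto simp: left_ideal_def)
    have "y \<in> I" using y I(1) by (auto simp: jacobson_radical_def)
    then have "a \<otimes> y \<in> I" using mul a by blast
    moreover have "?u \<in> I"
    proof -
      have "\<zero> \<oplus> \<one> \<otimes> ?u \<in> ?L" by blast
      then show ?thesis using I(2) uc by auto
    qed
    ultimately have "?u \<oplus> a \<otimes> y \<in> I" using I.a_closed by blast
    moreover have "?u \<oplus> a \<otimes> y = \<one>"
      using a yc by (simp add: minus_eq a_assoc l_neg)
    ultimately have one: "\<one> \<in> I" by simp
    have "r \<in> I" if "r \<in> carrier R" for r using mul[OF one that] that by simp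
    then show False using ne I.a_subset by blast
  qed
  then obtain w where "w \<in> carrier R" "\<one> = \<zero> \<oplus> w \<otimes> ?u" by auto
  then show thesis using that uc by auto
qed

text \<open>If \<open>w\<close> is a left inverse of \<open>1 - t s y\<close>, then \<open>1 + s y w t\<close> is one of \<open>1 - s y t\<close>.\<close>

lemma jacobson_radical_two_sided_left_inverse:
  assumes y: "y \<in> jacobson_radical R" and s: "s \<in> carrier R" and t: "t \<in> carrier R"
  obtains w where "w \<in> carrier R" "w \<otimes> (\<one> \<ominus> s \<otimes> y \<otimes> t) = \<one>"
proof -
  have yc: "y \<in> carrier R" using y by (simp add: jacobson_radical_def)
  obtain w where w: "w \<in> carrier R" "w \<otimes> (\<one> \<ominus> (t \<otimes> s) \<otimes> y) = \<one>"
    using jacobson_radical_left_inverse[OF y, of "t \<otimes> s"] s t by auto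
  define v where "v = s \<otimes> y"
  have vc: "v \<in> carrier R" using s yc by (simp add: v_def)
  have w2: "w \<ominus> w \<otimes> (t \<otimes> v) = \<one>"
    using w s t yc vc by (simp add: v_def minus_eq r_distr m_assoc r_minus)
  have "(\<one> \<oplus> v \<otimes> w \<otimes> t) \<otimes> (\<one> \<ominus> v \<otimes> t)
      = (\<one> \<ominus> v \<otimes> t) \<oplus> v \<otimes> (w \<ominus> w \<otimes> (t \<otimes> v)) \<otimes> t"
    using w s t yc vc by (simp add: minus_eq r_distr l_distr m_assoc r_minus l_minus minus_add a_ac)
  also have "\<dots> = \<one>" unfolding w2 using vc t by (simp add: minus_eq a_assoc l_neg)
  finally show thesis using that[of "\<one> \<oplus> v \<otimes> w \<otimes> t"] w vc t by (simp add: v_def)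
qed

lemma foldr_replicate_eq_pow:
  assumes "z \<in> carrier R"
  shows "foldr (\<otimes>) (replicate m z) \<one> = z [^] (m::nat)"
  using assms by (induction m) (auto simp: nat_pow_Suc2[symmetric] simp del: nat_pow_Suc foldr_replicate)

lemma nilpotent_ideal_pow_zero:
  assumes "nilpotent_ideal I R"
  obtains m :: nat where "m \<ge> 1" "\<And>z. z \<in> I \<Longrightarrow> z [^] m = \<zero>"
proof -
  obtain m where m: "m \<ge> 1" "products_vanish R I m"
    using assms by (auto simp: nilpotent_ideal_def)
  have "z [^] m = \<zero>" if "z \<in> I" for z
  proof -
    have "z \<in> carrier R"
      using assms that ideal.Icarr by (fastforce simp: nilpotent_ideal_def)
    moreover have "foldr (\<otimes>) (replicate m z) \<one> = \<zero>"
      using m(2) that by (simp add: products_vanish_def set_replicate_conv_if del: foldr_replicate)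
    ultimately show ?thesis using foldr_replicate_eq_pow by simp
  qed
  with m(1) show thesis using that by blast
qed

text \<open>Multiplying \<open>w \<otimes> (\<one> \<ominus> (e \<oplus> i)) = \<one>\<close> by
  \<open>e\<close> on the right cancels \<open>e\<close> against \<open>e \<otimes> e\<close> and
  leaves \<open>e = w \<otimes> (\<ominus> (i \<otimes> e))\<close>. So \<open>e\<close> lies in
  \<open>I\<close>, and a nilpotent idempotent is zero.\<close>

lemma idempotent_in_radical_mod_nilpotent:
  assumes y: "y \<in> jacobson_radical R" and s: "s \<in> carrier R" and t: "t \<in> carrier R"
    and I: "nilpotent_ideal I R" and i: "i \<in> I"
    and e: "e \<in> carrier R" "e \<otimes> e = e"
    and syt: "s \<otimes> y \<otimes> t = e \<oplus> i"
  shows "e = \<zero>"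
proof -
  interpret I: ideal I R using I by (simp add: nilpotent_ideal_def)
  have ic: "i \<in> carrier R" using i I.Icarr by blast
  obtain w where w: "w \<in> carrier R" "w \<otimes> (\<one> \<ominus> s \<otimes> y \<otimes> t) = \<one>"
    using jacobson_radical_two_sided_left_inverse[OF y s t] by blast
  have "e = w \<otimes> (\<one> \<ominus> (e \<oplus> i)) \<otimes> e" using w e by (simp add: syt)
  also have "\<dots> = w \<otimes> (e \<ominus> e \<otimes> e \<ominus> i \<otimes> e)"
    using w e(1) ic by (simp add: m_assoc minus_eq minus_add l_distr l_minus a_assoc)
  also have "\<dots> = w \<otimes> (\<ominus> (i \<otimes> e))"
    using w e ic by (simp add: minus_eq r_neg)
  finally have eq: "e = w \<otimes> (\<ominus> (i \<otimes> e))" .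
  have "w \<otimes> (\<ominus> (i \<otimes> e)) \<in> I"
    using i e w by (intro I.I_l_closed I.a_inv_closed I.I_r_closed)
  then have eI: "e \<in> I" using eq by simp
  obtain m :: nat where m: "m \<ge> 1" "\<And>z. z \<in> I \<Longrightarrow> z [^] m = \<zero>"
    using nilpotent_ideal_pow_zero[OF I] by blast
  have "e [^] Suc k = e" for k :: nat
    using e by (induction k) auto
  then have "e [^] m = e" using m(1) by (metis Suc_le_D One_nat_def)
  then show ?thesis using m(2)[OF eI] by simp
qed

text \<open>If \<open>u\<close> missed a maximal left ideal \<open>I\<close>, the two would generate
  the ring, so \<open>\<one>\<close> would be an element of \<open>I\<close> plus a left multiple
  \<open>z\<close> of \<open>u\<close>. As \<open>z\<close> is nilpotent, this forces
  \<open>\<one>\<close> into \<open>I\<close>.\<close>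

lemma nilpotent_ideal_le_jacobson_radical:
  assumes N: "nilpotent_ideal N R"
  shows "N \<subseteq> jacobson_radical R"
proof
  fix u assume u: "u \<in> N"
  interpret N: ideal N R using N by (simp add: nilpotent_ideal_def)
  have uc: "u \<in> carrier R" using u N.Icarr by blast
  have "u \<in> I" if I: "maximal_left_ideal I R" for I
  proof (rule ccontr)
    assume nu: "u \<notin> I"
    have li: "left_ideal I R" and ne: "I \<noteq> carrier R"
      using I by (auto simp: maximal_left_ideal_def)
    interpret I: additive_subgroup I R using li by (simp add: left_ideal_def)
    have mul: "r \<otimes> m \<in> I" if "m \<in> I" "r \<in> carrier R" for m r
      using that li by (auto simp: left_ideal_def)
    have Ic: "m \<in> carrier R" if "m \<in> I" for m using that I.a_subset by blast
    let ?J = "{m \<oplus> r \<otimes> u | m r. m \<in> I \<and> r \<in> carrier R}"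
    have "left_ideal ?J R" by (rule left_ideal_translates[OF li uc])
    moreover have "I \<subseteq> ?J"
    proof
      fix m assume "m \<in> I"
      then have "m = m \<oplus> \<zero> \<otimes> u" "m \<in> I" using Ic uc by auto
      then show "m \<in> ?J" by blast
    qed
    moreover have "u \<in> ?J"
    proof -
      have "u = \<zero> \<oplus> \<one> \<otimes> u" using uc by simp
      then show ?thesis using I.zero_closed by blast
    qed
    ultimately have "?J = carrier R" using I nu unfolding maximal_left_ideal_def by blast
    then have "\<one> \<in> ?J" using one_closed by blast
    then obtain m0 r where m0: "m0 \<in> I" "r \<in> carrier R" "\<one> = m0 \<oplus> r \<otimes> u" by auto
    define z where "z = r \<otimes> u"
    have zN: "z \<in> N" using m0 u N.I_l_closed by (simp add: z_def)
    then have zc: "z \<in> carrier R" using N.Icarr by blast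
    \<comment> \<open>Multiplying \<open>\<one> = m0 \<oplus> z\<close> by \<open>z [^] k\<close> on
      the left rewrites \<open>z [^] k\<close> as an element of \<open>I\<close> plus
      \<open>z [^] Suc k\<close>.\<close>
    have "\<exists>m\<in>I. \<one> = m \<oplus> z [^] k" for k :: nat
    proof (induction k)
      case 0
      then show ?case using I.zero_closed by auto
    next
      case (Suc k)
      then obtain m where m: "m \<in> I" "\<one> = m \<oplus> z [^] k" by blast
      have "z [^] k = z [^] k \<otimes> \<one>" using zc by simp
      also have "\<dots> = z [^] k \<otimes> (m0 \<oplus> z)" using m0(3) by (simp only: z_def)
      also have "\<dots> = z [^] k \<otimes> m0 \<oplus> z [^] Suc k" using zc Ic m0 by (simp add: r_distr)
      finally have "\<one> = (m \<oplus> z [^] k \<otimes> m0) \<oplus> z [^] Suc k"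
        using m Ic m0 zc by (simp add: a_assoc)
      moreover have "m \<oplus> z [^] k \<otimes> m0 \<in> I" using m m0 zc mul by (simp add: I.a_closed)
      ultimately show ?case by blast
    qed
    moreover obtain k :: nat where "z [^] k = \<zero>"
      using nilpotent_ideal_pow_zero[OF N] zN by blast
    ultimately obtain m where "m \<in> I" "\<one> = m \<oplus> \<zero>" by metis
    then have one: "\<one> \<in> I" using Ic by auto
    have "r \<in> I" if "r \<in> carrier R" for r using mul[OF one that] that by simp
    then show False using ne I.a_subset by blast
  qed
  then show "u \<in> jacobson_radical R" using uc by (simp add: jacobson_radical_def)
qed

end

section \<open>Linear spans of matrices\<close>

text \<open>The operations of \<open>matrix_algebra\<close> as plain functions. Associativity and
  linearity then hold for all arguments, without carrier conditions.\<close>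

definition mat_mul :: "'x set \<Rightarrow> ('x \<Rightarrow> 'x \<Rightarrow> 'f::field) \<Rightarrow> ('x \<Rightarrow> 'x \<Rightarrow> 'f) \<Rightarrow> 'x \<Rightarrow> 'x \<Rightarrow> 'f"
  where "mat_mul Y M N = (\<lambda>y z. \<Sum>w\<in>Y. M y w * N w z)"

definition mat_scale :: "'f::field \<Rightarrow> ('x \<Rightarrow> 'x \<Rightarrow> 'f) \<Rightarrow> 'x \<Rightarrow> 'x \<Rightarrow> 'f"
  where "mat_scale c M = (\<lambda>y z. c * M y z)"

definition mat_add :: "('x \<Rightarrow> 'x \<Rightarrow> 'f::field) \<Rightarrow> ('x \<Rightarrow> 'x \<Rightarrow> 'f) \<Rightarrow> 'x \<Rightarrow> 'x \<Rightarrow> 'f"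
  where "mat_add M N = (\<lambda>y z. M y z + N y z)"

definition mat_zero :: "'x \<Rightarrow> 'x \<Rightarrow> 'f::field"
  where "mat_zero = (\<lambda>y z. 0)"

lemma matrix_algebra_simps [simp]:
  "monoid.mult (matrix_algebra Y) = mat_mul Y"
  "ring.zero (matrix_algebra Y) = mat_zero"
  "ring.add (matrix_algebra Y) = mat_add"
  "module.smult (matrix_algebra Y) = mat_scale"
  by (simp_all add: matrix_algebra_def mat_mul_def mat_zero_def mat_add_def mat_scale_def fun_eq_iff)

lemma ring_of_type_algebra_carrier [simp]: "carrier ring_of_type_algebra = UNIV"
  by (simp add: ring_of_type_algebra_def)

lemma mat_mul_assoc: "mat_mul Y (mat_mul Y M N) K = mat_mul Y M (mat_mul Y N K)"
  by (simp add: mat_mul_def fun_eq_iff sum_distrib_left sum_distrib_right mult.assoc)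
    (auto intro: sum.swap)

lemma mat_mul_linear:
  "mat_mul Y (mat_add M N) K = mat_add (mat_mul Y M K) (mat_mul Y N K)"
  "mat_mul Y K (mat_add M N) = mat_add (mat_mul Y K M) (mat_mul Y K N)"
  "mat_mul Y (mat_scale c M) K = mat_scale c (mat_mul Y M K)"
  "mat_mul Y K (mat_scale c M) = mat_scale c (mat_mul Y K M)"
  "mat_mul Y mat_zero K = mat_zero"
  "mat_mul Y K mat_zero = mat_zero"
  by (simp_all add: mat_mul_def mat_add_def mat_scale_def mat_zero_def fun_eq_iff algebra_simps
      sum.distrib sum_distrib_left)

definition lin_closed :: "('x \<Rightarrow> 'x \<Rightarrow> 'f::field) set \<Rightarrow> bool"
  where "lin_closed L \<longleftrightarrow> mat_zero \<in> L \<and> (\<forall>M\<in>L. \<forall>N\<in>L. mat_add M N \<in> L)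
    \<and> (\<forall>c. \<forall>M\<in>L. mat_scale c M \<in> L)"

text \<open>Membership is demanded only where the coefficient is nonzero, so that an expansion over
  all index functions can be used when the terms of too low degree have coefficient zero.\<close>

lemma lin_closed_sum:
  assumes "lin_closed L" "finite A" "\<And>v. v \<in> A \<Longrightarrow> c v \<noteq> 0 \<Longrightarrow> f v \<in> L"
  shows "(\<lambda>y z. \<Sum>v\<in>A. c v * f v y z) \<in> L"
  using assms(2,3)
proof (induction A rule: finite_induct)
  case empty
  then show ?case using assms(1) by (simp add: lin_closed_def mat_zero_def)
next
  case (insert v A)
  have "mat_scale (c v) (f v) \<in> L"
  proof (cases "c v = 0")
    case True
    then have "mat_scale (c v) (f v) = mat_zero" by (simp add: mat_scale_def mat_zero_def)
    then show ?thesis using assms(1) by (simp add: lin_closed_def)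
  next
    case False
    then show ?thesis using insert assms(1) by (auto simp: lin_closed_def)
  qed
  then have "mat_add (mat_scale (c v) (f v)) (\<lambda>y z. \<Sum>v\<in>A. c v * f v y z) \<in> L"
    using insert assms(1) by (auto simp: lin_closed_def)
  then show ?case using insert by (simp add: mat_add_def mat_scale_def)
qed

context
  fixes Y :: "'x set"
  assumes finY: "finite Y"
begin

interpretation M: ring "matrix_algebra Y :: ('f::field, 'x \<Rightarrow> 'x \<Rightarrow> 'f) module"
  by (rule ring_matrix_algebra[OF finY])

lemma finsum_matrix_algebra:
  assumes "finite A" "f \<in> A \<rightarrow> carrier (matrix_algebra Y)"
  shows "(\<Oplus>\<^bsub>(matrix_algebra Y :: ('f::field, 'x \<Rightarrow> 'x \<Rightarrow> 'f) module)\<^esub>v\<in>A. f v)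
    = (\<lambda>y z. \<Sum>v\<in>A. f v y z)"
  using assms
proof (induction A rule: finite_induct)
  case empty
  then show ?case by (simp add: mat_zero_def)
next
  case (insert v A)
  have "finsum (matrix_algebra Y) f (insert v A) = f v \<oplus>\<^bsub>matrix_algebra Y\<^esub> finsum (matrix_algebra Y) f A"
    using insert by (intro M.finsum_insert) auto
  then show ?case using insert by (simp add: mat_add_def)
qed

lemma lin_span_eq:
  assumes "S \<subseteq> carrier (matrix_algebra Y :: ('f::field, 'x \<Rightarrow> 'x \<Rightarrow> 'f) module)"
  shows "lin_span ring_of_type_algebra (matrix_algebra Y :: ('f, 'x \<Rightarrow> 'x \<Rightarrow> 'f) module) S
    = {(\<lambda>y z. \<Sum>v\<in>A. c v * v y z) | A c. finite A \<and> A \<subseteq> S}"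
proof -
  have "(\<Oplus>\<^bsub>(matrix_algebra Y :: ('f, 'x \<Rightarrow> 'x \<Rightarrow> 'f) module)\<^esub>v\<in>A.
      c v \<odot>\<^bsub>(matrix_algebra Y :: ('f, 'x \<Rightarrow> 'x \<Rightarrow> 'f) module)\<^esub> v)
    = (\<lambda>y z. \<Sum>v\<in>A. c v * v y z)" if "finite A" "A \<subseteq> S" for A and c :: "('x \<Rightarrow> 'x \<Rightarrow> 'f) \<Rightarrow> 'f"
  proof -
    have "(\<lambda>v. mat_scale (c v) v) \<in> A \<rightarrow> carrier (matrix_algebra Y)"
      using that assms by (auto simp: matrix_algebra_def mat_scale_def subset_iff)
    from finsum_matrix_algebra[OF that(1) this] show ?thesis by (simp add: mat_scale_def)
  qed
  then show ?thesis unfolding lin_span_def by (simp cong: conj_cong) (metis (lifting))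
qed

lemma lin_span_least:
  assumes "S \<subseteq> carrier (matrix_algebra Y :: ('f::field, 'x \<Rightarrow> 'x \<Rightarrow> 'f) module)"
    and "lin_closed L" "S \<subseteq> L"
  shows "lin_span ring_of_type_algebra (matrix_algebra Y :: ('f, 'x \<Rightarrow> 'x \<Rightarrow> 'f) module) S \<subseteq> L"
proof -
  have "(\<lambda>y z. \<Sum>v\<in>A. c v * v y z) \<in> L" if "finite A" "A \<subseteq> S" for A and c :: "('x \<Rightarrow> 'x \<Rightarrow> 'f) \<Rightarrow> 'f"
    using lin_closed_sum[OF assms(2) that(1), of c "\<lambda>v. v"] that assms by blast
  then show ?thesis unfolding lin_span_eq[OF assms(1)] by blast
qed

lemma lin_span_closed:
  assumes "S \<subseteq> carrier (matrix_algebra Y :: ('f::field, 'x \<Rightarrow> 'x \<Rightarrow> 'f) module)"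
  shows "lin_closed (lin_span ring_of_type_algebra (matrix_algebra Y :: ('f, 'x \<Rightarrow> 'x \<Rightarrow> 'f) module) S)"
    (is "lin_closed ?L")
proof -
  note eq = lin_span_eq[OF assms]
  have "mat_zero \<in> ?L" unfolding eq by (auto simp: mat_zero_def intro!: exI[of _ "{}"])
  moreover have "mat_add M N \<in> ?L" if MN: "M \<in> ?L" "N \<in> ?L" for M N
  proof -
    obtain A c where A: "finite A" "A \<subseteq> S" "M = (\<lambda>y z. \<Sum>v\<in>A. c v * v y z)"
      using MN(1) unfolding eq by blast
    obtain B d where B: "finite B" "B \<subseteq> S" "N = (\<lambda>y z. \<Sum>v\<in>B. d v * v y z)"
      using MN(2) unfolding eq by blast
    \<comment> \<open>The index sets may overlap, so both coefficient functions are extended by zero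
      to the union and added there.\<close>
    let ?c = "\<lambda>v. (if v \<in> A then c v else 0) + (if v \<in> B then d v else 0)"
    have "M y z = (\<Sum>v\<in>A \<union> B. (if v \<in> A then c v else 0) * v y z)" for y z
      unfolding A(3) using A(1) B(1) by (intro sum.mono_neutral_cong_left) auto
    moreover have "N y z = (\<Sum>v\<in>A \<union> B. (if v \<in> B then d v else 0) * v y z)" for y z
      unfolding B(3) using A(1) B(1) by (intro sum.mono_neutral_cong_left) auto
    ultimately have "mat_add M N = (\<lambda>y z. \<Sum>v\<in>A \<union> B. ?c v * v y z)"
      by (simp add: mat_add_def sum.distrib distrib_right)
    moreover have "finite (A \<union> B)" "A \<union> B \<subseteq> S" using A B by auto
    ultimately show ?thesis unfolding eq mem_Collect_eq by (intro exI conjI)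
  qed
  moreover have "mat_scale a M \<in> ?L" if M: "M \<in> ?L" for a M
  proof -
    obtain A c where A: "finite A" "A \<subseteq> S" "M = (\<lambda>y z. \<Sum>v\<in>A. c v * v y z)"
      using M unfolding eq by blast
    then have "mat_scale a M = (\<lambda>y z. \<Sum>v\<in>A. (a * c v) * v y z)"
      by (simp add: mat_scale_def sum_distrib_left mult.assoc)
    with A(1,2) show ?thesis unfolding eq mem_Collect_eq by (intro exI conjI)
  qed
  ultimately show ?thesis by (simp add: lin_closed_def)
qed

lemma lin_span_superset:
  assumes "S \<subseteq> carrier (matrix_algebra Y :: ('f::field, 'x \<Rightarrow> 'x \<Rightarrow> 'f) module)"
  shows "S \<subseteq> lin_span ring_of_type_algebra (matrix_algebra Y :: ('f, 'x \<Rightarrow> 'x \<Rightarrow> 'f) module) S"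
proof
  fix v assume "v \<in> S"
  then have "v = (\<lambda>y z. \<Sum>v\<in>{v}. 1 * v y z)" "finite {v}" "{v} \<subseteq> S" by auto
  then show "v \<in> lin_span ring_of_type_algebra (matrix_algebra Y) S"
    unfolding lin_span_eq[OF assms] mem_Collect_eq
    by (intro exI[of _ "{v}"] exI[of _ "\<lambda>_. 1"]) blast
qed

text \<open>Bilinearity in two steps: for a fixed factor, the matrices whose product with it lies in
  \<open>L\<close> form a subspace, so testing on the spanning sets suffices, first for
  \<open>M\<close>, then for \<open>N\<close>.\<close>

lemma lin_span_mat_mul:
  assumes S: "S \<subseteq> carrier (matrix_algebra Y :: ('f::field, 'x \<Rightarrow> 'x \<Rightarrow> 'f) module)"
    and S': "S' \<subseteq> carrier (matrix_algebra Y :: ('f::field, 'x \<Rightarrow> 'x \<Rightarrow> 'f) module)"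
    and L: "lin_closed L" and SS': "\<And>M N. M \<in> S \<Longrightarrow> N \<in> S' \<Longrightarrow> mat_mul Y M N \<in> L"
    and M: "M \<in> lin_span ring_of_type_algebra (matrix_algebra Y :: ('f, 'x \<Rightarrow> 'x \<Rightarrow> 'f) module) S"
    and N: "N \<in> lin_span ring_of_type_algebra (matrix_algebra Y :: ('f, 'x \<Rightarrow> 'x \<Rightarrow> 'f) module) S'"
  shows "mat_mul Y M N \<in> L"
proof -
  have "lin_closed {M. mat_mul Y M N \<in> L}" for N
    using L by (auto simp: lin_closed_def mat_mul_linear)
  then have 1: "mat_mul Y M N \<in> L" if "N \<in> S'" for N
    using lin_span_least[OF S, of "{M. mat_mul Y M N \<in> L}"] SS' M that by blast
  have "lin_closed {N. mat_mul Y M N \<in> L}"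
    using L by (auto simp: lin_closed_def mat_mul_linear)
  then show ?thesis
    using lin_span_least[OF S', of "{N. mat_mul Y M N \<in> L}"] 1 N by blast
qed

lemma submodule_lin_closed:
  assumes "submodule H ring_of_type_algebra (matrix_algebra Y :: ('f::field, 'x \<Rightarrow> 'x \<Rightarrow> 'f) module)"
  shows "lin_closed H"
  using module.submoduleE[OF module_matrix_algebra[OF finY] assms]
    subgroup.one_closed[OF submodule.axioms(1)[OF assms]]
  by (auto simp: lin_closed_def)

lemma lin_closed_submodule:
  assumes "H \<subseteq> carrier (matrix_algebra Y :: ('f::field, 'x \<Rightarrow> 'x \<Rightarrow> 'f) module)" and "lin_closed H"
  shows "submodule H ring_of_type_algebra (matrix_algebra Y :: ('f::field, 'x \<Rightarrow> 'x \<Rightarrow> 'f) module)"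
proof (rule module.submoduleI[OF module_matrix_algebra[OF finY]])
  show "\<ominus>\<^bsub>matrix_algebra Y\<^esub> a \<in> H" if "a \<in> H" for a
  proof -
    have c: "mat_scale (-1) a \<in> H" using that assms by (auto simp: lin_closed_def)
    moreover have "\<ominus>\<^bsub>matrix_algebra Y\<^esub> a = mat_scale (-1) a"
      using that assms c by (intro M.minus_equality)
        (auto simp: mat_add_def mat_scale_def mat_zero_def)
    ultimately show ?thesis by simp
  qed
qed (use assms in \<open>auto simp: lin_closed_def\<close>)

end

section \<open>One coordinate\<close>

datatype kind = Ke | KR | KC | KI | KJ

lemma UNIV_kind: "UNIV = {Ke, KR, KC, KI, KJ}"
  using kind.exhaust by auto

lemma finite_kind [simp]: "finite (UNIV :: kind set)"
  by (simp add: UNIV_kind)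

lemma sum_kind:
  "(\<Sum>k\<in>UNIV. f k) = f Ke + f KR + f KC + f KI + (f KJ :: 'a::comm_monoid_add)"
  by (simp add: UNIV_kind add.assoc)

fun kind_rel :: "'u \<Rightarrow> kind \<Rightarrow> 'u \<Rightarrow> 'u \<Rightarrow> bool" where
  "kind_rel x Ke y z \<longleftrightarrow> y = x \<and> z = x"
| "kind_rel x KR y z \<longleftrightarrow> y = x \<and> z \<noteq> x"
| "kind_rel x KC y z \<longleftrightarrow> y \<noteq> x \<and> z = x"
| "kind_rel x KI y z \<longleftrightarrow> y \<noteq> x \<and> z = y"
| "kind_rel x KJ y z \<longleftrightarrow> y \<noteq> x \<and> z \<noteq> x"

definition loc :: "'u set \<Rightarrow> 'u \<Rightarrow> kind \<Rightarrow> 'u \<Rightarrow> 'u \<Rightarrow> 'f::field"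
  where "loc V x k = (\<lambda>y z. of_bool (y \<in> V \<and> z \<in> V \<and> kind_rel x k y z))"

text \<open>A product of two local matrices is \<open>kind_coef\<close> times the matrix of kind
  \<open>kind_mul\<close>. Where the product is zero, the value of \<open>kind_mul\<close> is an
  arbitrary default.\<close>

fun kind_mul :: "kind \<Rightarrow> kind \<Rightarrow> kind" where
  "kind_mul Ke l = l"
| "kind_mul KI l = l"
| "kind_mul KR KC = Ke"
| "kind_mul KR l = KR"
| "kind_mul KC Ke = KC"
| "kind_mul KC l = KJ"
| "kind_mul KJ KC = KC"
| "kind_mul KJ l = KJ"

text \<open>The order of the equations matters: the clause for the right factor \<open>KI\<close> is
  reached only by the left factors \<open>KR\<close> and \<open>KJ\<close>.\<close>

fun kind_coef :: "'f::field \<Rightarrow> kind \<Rightarrow> kind \<Rightarrow> 'f" where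
  "kind_coef m Ke l = of_bool (l = Ke \<or> l = KR)"
| "kind_coef m KC l = of_bool (l = Ke \<or> l = KR)"
| "kind_coef m KI l = of_bool (l = KC \<or> l = KI \<or> l = KJ)"
| "kind_coef m k KI = 1"
| "kind_coef m k l = (if l = KC \<or> l = KJ then m else 0)"

fun kind_deg :: "kind \<Rightarrow> nat" where
  "kind_deg Ke = 0" | "kind_deg KI = 0" | "kind_deg KR = 1" | "kind_deg KC = 1" | "kind_deg KJ = 2"

text \<open>At \<open>m = 0\<close> only the products without a factor \<open>m\<close> survive, and
  on these the degrees add. This is the local reason for the filtration.\<close>

lemma kind_deg_mul:
  "kind_coef 0 k l \<noteq> 0 \<Longrightarrow> kind_deg (kind_mul k l) \<ge> kind_deg k + kind_deg l"
  by (cases k; cases l) auto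

lemma kind_deg_le: "kind_deg k \<le> 2"
  by (cases k) auto

text \<open>An entry of the product counts the intermediate points \<open>w\<close>. They form the
  empty set, a single point or \<open>V - {x}\<close>; the last case is the source of the factor
  \<open>m\<close>.\<close>

lemma mat_mul_loc:
  assumes V: "finite V" and x: "x \<in> V"
  shows "mat_mul V (loc V x k) (loc V x l)
    = mat_scale (kind_coef (of_nat (card V - 1)) k l) (loc V x (kind_mul k l) :: _ \<Rightarrow> _ \<Rightarrow> 'f::field)"
proof (intro ext)
  fix y z
  let ?S = "V \<inter> {w. y \<in> V \<and> z \<in> V \<and> kind_rel x k y w \<and> kind_rel x l w z}"
  have 1: "mat_mul V (loc V x k) (loc V x l) y z = (of_nat (card ?S) :: 'f)"
  proof -
    have "mat_mul V (loc V x k) (loc V x l) y z =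
        (\<Sum>w\<in>V. of_bool (y \<in> V \<and> z \<in> V \<and> kind_rel x k y w \<and> kind_rel x l w z) :: 'f)"
      unfolding mat_mul_def loc_def by (intro sum.cong) auto
    also have "\<dots> = of_nat (card ?S)"
      using V by simp
    finally show ?thesis .
  qed
  have cx: "card (V - {x}) = card V - 1" using x by (simp add: V)
  have S: "?S = {}" if "\<not> (y \<in> V \<and> z \<in> V)" using that by auto
  have "of_nat (card ?S) = kind_coef (of_nat (card V - 1)) k l * (loc V x (kind_mul k l) y z :: 'f)"
  proof (cases "y \<in> V \<and> z \<in> V")
    case True
    then have "?S = V \<inter> {w. kind_rel x k y w \<and> kind_rel x l w z}" by simp
    moreover have "V \<inter> {w. kind_rel x k y w \<and> kind_rel x l w z} =
      (if kind_rel x (kind_mul k l) y z then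
         (if k = Ke \<or> k = KC then (if l = Ke \<or> l = KR then {x} else {})
          else if l = Ke \<or> l = KR then {} else if k = KI then {y} else if l = KI then {z} else V - {x})
       else {})"
      using True x by (cases k; cases l) auto
    ultimately show ?thesis using True cx by (cases k; cases l) (auto simp: loc_def)
  next
    case False
    then show ?thesis unfolding S[OF False] by (auto simp: loc_def)
  qed
  then show "mat_mul V (loc V x k) (loc V x l) y z
    = (mat_scale (kind_coef (of_nat (card V - 1)) k l) (loc V x (kind_mul k l)) y z :: 'f)"
    using 1 by (simp add: mat_scale_def)
qed

text \<open>If \<open>V\<close> consists of \<open>x\<close> and one more point, the matrix of kind
  \<open>KI\<close> here is zero. Hence these matrices span without being independent in general,
  and later arguments cannot compare coefficients.\<close>

definition loc_unit :: "'u set \<Rightarrow> 'u \<Rightarrow> kind \<Rightarrow> 'u \<Rightarrow> 'u \<Rightarrow> 'f::field"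
  where "loc_unit V x k = (let m = of_nat (card V - 1) in
    if m = 0 then loc V x k else
    case k of Ke \<Rightarrow> loc V x Ke | KR \<Rightarrow> loc V x KR | KC \<Rightarrow> mat_scale (1 / m) (loc V x KC)
    | KJ \<Rightarrow> mat_scale (1 / m) (loc V x KJ)
    | KI \<Rightarrow> mat_add (loc V x KI) (mat_scale (- 1 / m) (loc V x KJ)))"

definition loc_coef :: "'f::field \<Rightarrow> kind \<Rightarrow> kind \<Rightarrow> 'f"
  where "loc_coef m k l = (if m = 0 then of_bool (k = l) else
     case k of KC \<Rightarrow> m * of_bool (l = KC) | KJ \<Rightarrow> m * of_bool (l = KJ)
     | KI \<Rightarrow> of_bool (l = KI \<or> l = KJ) | _ \<Rightarrow> of_bool (l = k))"

lemma loc_expand: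
  "loc V x k y z = (\<Sum>l\<in>UNIV. loc_coef (of_nat (card V - 1)) k l * (loc_unit V x l y z :: 'f::field))"
  by (cases k) (auto simp: sum_kind loc_coef_def loc_unit_def Let_def mat_scale_def mat_add_def)

text \<open>Write \<open>e, R, C/m, J/m\<close> as matrix units \<open>E00, E01, E10, E11\<close>.
  For a kind standing for \<open>Erc\<close>, this function and the next four yield
  \<open>E0r\<close>, \<open>Ec0\<close>, \<open>Er0\<close>, \<open>E0c\<close> and
  \<open>E00\<close>, in this order. The complementary idempotent \<open>KI\<close> is fixed by all
  of them.\<close>

fun kind_lft :: "kind \<Rightarrow> kind" where
  "kind_lft KI = KI" | "kind_lft Ke = Ke" | "kind_lft KR = Ke" | "kind_lft KC = KR" | "kind_lft KJ = KR"
fun kind_rgt :: "kind \<Rightarrow> kind" where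
  "kind_rgt KI = KI" | "kind_rgt Ke = Ke" | "kind_rgt KR = KC" | "kind_rgt KC = Ke" | "kind_rgt KJ = KC"
fun kind_row :: "kind \<Rightarrow> kind" where
  "kind_row KI = KI" | "kind_row Ke = Ke" | "kind_row KR = Ke" | "kind_row KC = KC" | "kind_row KJ = KC"
fun kind_col :: "kind \<Rightarrow> kind" where
  "kind_col KI = KI" | "kind_col Ke = Ke" | "kind_col KR = KR" | "kind_col KC = Ke" | "kind_col KJ = KR"
fun kind_core :: "kind \<Rightarrow> kind" where
  "kind_core KI = KI" | "kind_core k = Ke"

lemma mat_scale_simps:
  "mat_scale a (mat_scale b M) = mat_scale (a * b) M"
  "mat_scale a (mat_add M N) = mat_add (mat_scale a M) (mat_scale a N)"
  "mat_scale 1 M = M"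
  "mat_scale 0 M = mat_zero"
  "mat_scale a mat_zero = mat_zero"
  "mat_add mat_zero M = M"
  "mat_add M mat_zero = M"
  "mat_add M (mat_scale a M) = mat_scale (1 + a) M"
  "mat_add (mat_scale b M) (mat_scale a M) = mat_scale (b + a) M"
  "mat_add (mat_scale b M) M = mat_scale (b + 1) M"
  "mat_add (mat_add K M) N = mat_add K (mat_add M N)"
  by (auto simp: mat_scale_def mat_add_def mat_zero_def fun_eq_iff algebra_simps)

text \<open>The multiplication table of matrix units: without \<open>KI\<close>, the condition
  compares the column index of \<open>k\<close> with the row index of \<open>l\<close>. The scalars
  \<open>1 / m\<close> absorb every factor \<open>m\<close>.\<close>

lemma mat_mul_loc_unit:
  fixes V :: "'u set"
  assumes V: "finite V" "x \<in> V" and m: "of_nat (card V - 1) \<noteq> (0::'f)"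
  shows "mat_mul V (loc_unit V x k) (loc_unit V x l)
    = (mat_scale (of_bool (if k = KI \<or> l = KI then k = l else (k = Ke \<or> k = KC) = (l = Ke \<or> l = KR)))
       (loc_unit V x (kind_mul k l)) :: 'u \<Rightarrow> 'u \<Rightarrow> 'f::field)"
  using m by (cases k; cases l)
    (simp_all add: loc_unit_def mat_mul_linear mat_mul_loc[OF V] mat_scale_simps)

lemma loc_unit_sandwich:
  fixes V :: "'u set"
  assumes V: "finite V" "x \<in> V"
    and kl: "of_nat (card V - 1) = (0::'f) \<Longrightarrow> kind_deg k = 0 \<and> kind_deg l = 0"
  shows "mat_mul V (mat_mul V (loc_unit V x (kind_lft k)) (loc_unit V x l)) (loc_unit V x (kind_rgt k))
    = (mat_scale (of_bool (k = l)) (loc_unit V x (kind_core k)) :: 'u \<Rightarrow> 'u \<Rightarrow> 'f::field)"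
proof (cases "of_nat (card V - 1) = (0::'f)")
  case True
  then show ?thesis using kl
    by (cases k; cases l) (simp_all add: loc_unit_def mat_mul_linear mat_mul_loc[OF V] mat_scale_simps)
next
  case False
  show ?thesis
    by (cases k; cases l) (simp_all add: mat_mul_linear mat_mul_loc_unit[OF V False] mat_scale_simps)
qed

text \<open>\<open>Er0 E00 E0c = Erc\<close>. At \<open>m = 0\<close> it still holds, since
  \<open>C e R = J\<close> involves no factor \<open>m\<close>. It shows that a basis matrix
  vanishes once its core does.\<close>

lemma loc_unit_recover:
  fixes V :: "'u set"
  assumes V: "finite V" "x \<in> V"
  shows "mat_mul V (mat_mul V (loc_unit V x (kind_row k)) (loc_unit V x (kind_core k))) (loc_unit V x (kind_col k))
    = (loc_unit V x k :: 'u \<Rightarrow> 'u \<Rightarrow> 'f::field)"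
proof (cases "of_nat (card V - 1) = (0::'f)")
  case True
  then show ?thesis
    by (cases k) (simp_all add: loc_unit_def mat_mul_linear mat_mul_loc[OF V] mat_scale_simps)
next
  case False
  show ?thesis
    by (cases k) (simp_all add: mat_mul_linear mat_mul_loc_unit[OF V False] mat_scale_simps)
qed

lemma loc_unit_core_idem:
  fixes V :: "'u set"
  assumes V: "finite V" "x \<in> V"
  shows "mat_mul V (loc_unit V x (kind_core k)) (loc_unit V x (kind_core k))
    = (loc_unit V x (kind_core k) :: 'u \<Rightarrow> 'u \<Rightarrow> 'f::field)"
proof (cases "of_nat (card V - 1) = (0::'f)")
  case True
  then show ?thesis
    by (cases k) (simp_all add: loc_unit_def mat_mul_linear mat_mul_loc[OF V] mat_scale_simps)
next
  case False
  show ?thesis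
    by (cases k) (simp_all add: mat_mul_linear mat_mul_loc_unit[OF V False] mat_scale_simps)
qed

section \<open>Tensor products and the degree filtration\<close>

definition tens :: "nat \<Rightarrow> (nat \<Rightarrow> 'u set) \<Rightarrow> (nat \<Rightarrow> 'u \<Rightarrow> 'u \<Rightarrow> 'f::field) \<Rightarrow> (nat \<Rightarrow> 'u) \<Rightarrow> (nat \<Rightarrow> 'u) \<Rightarrow> 'f"
  where "tens n U M = (\<lambda>y z. if y \<in> points n U \<and> z \<in> points n U then \<Prod>a=1..n. M a (y a) (z a) else 0)"

lemma tens_cong:
  assumes "\<And>a. a \<in> {1..n} \<Longrightarrow> M a = N a"
  shows "tens n U M = tens n U N"
  using assms by (auto simp: tens_def fun_eq_iff intro!: prod.cong)

lemma tens_scale: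
  "tens n U (\<lambda>a. mat_scale (c a) (M a)) = mat_scale (\<Prod>a=1..n. c a) (tens n U M)"
  by (auto simp: tens_def mat_scale_def fun_eq_iff prod.distrib)

text \<open>The intermediate points form a product set, so the sum over them of a product over
  coordinates factors into local sums.\<close>

lemma tens_mul:
  assumes "\<And>a. a \<in> {1..n} \<Longrightarrow> finite (U a)"
  shows "mat_mul (points n U) (tens n U M) (tens n U N) = tens n U (\<lambda>a. mat_mul (U a) (M a) (N a))"
proof (intro ext)
  fix y z
  show "mat_mul (points n U) (tens n U M) (tens n U N) y z = tens n U (\<lambda>a. mat_mul (U a) (M a) (N a)) y z"
  proof (cases "y \<in> points n U \<and> z \<in> points n U")
    case True
    then have "mat_mul (points n U) (tens n U M) (tens n U N) y z
      = (\<Sum>w\<in>points n U. \<Prod>a=1..n. M a (y a) (w a) * N a (w a) (z a))"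
      unfolding mat_mul_def tens_def by (intro sum.cong) (auto simp: prod.distrib)
    also have "\<dots> = (\<Prod>a=1..n. \<Sum>w\<in>U a. M a (y a) w * N a w (z a))"
      unfolding points_def using assms by (subst prod_sum_PiE) auto
    finally show ?thesis using True by (simp add: tens_def mat_mul_def)
  next
    case False
    then show ?thesis by (auto simp: tens_def mat_mul_def)
  qed
qed

lemma tens_carrier: "tens n U M \<in> carrier (matrix_algebra (points n U))"
  by (auto simp: matrix_algebra_def tens_def)

lemma tens_expand:
  fixes M :: "nat \<Rightarrow> 'u \<Rightarrow> 'u \<Rightarrow> 'f::field" and N :: "nat \<Rightarrow> kind \<Rightarrow> 'u \<Rightarrow> 'u \<Rightarrow> 'f"
  assumes "\<And>a y z. a \<in> {1..n} \<Longrightarrow> y \<in> U a \<Longrightarrow> z \<in> U a \<Longrightarrow> M a y z = (\<Sum>k\<in>UNIV. c a k * N a k y z)"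
  shows "tens n U M = (\<lambda>y z. \<Sum>\<beta>\<in>(\<Pi>\<^sub>E a\<in>{1..n}. UNIV). (\<Prod>a=1..n. c a (\<beta> a)) * tens n U (\<lambda>a. N a (\<beta> a)) y z)"
proof (intro ext)
  fix y z
  show "tens n U M y z = (\<Sum>\<beta>\<in>(\<Pi>\<^sub>E a\<in>{1..n}. UNIV). (\<Prod>a=1..n. c a (\<beta> a)) * tens n U (\<lambda>a. N a (\<beta> a)) y z)"
  proof (cases "y \<in> points n U \<and> z \<in> points n U")
    case True
    then have "y a \<in> U a" "z a \<in> U a" if "a \<in> {1..n}" for a
      using that by (auto simp: points_def PiE_def Pi_def)
    then have "tens n U M y z = (\<Prod>a=1..n. \<Sum>k\<in>UNIV. c a k * N a k (y a) (z a))"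
      using True assms by (simp add: tens_def)
    also have "\<dots> = (\<Sum>\<beta>\<in>(\<Pi>\<^sub>E a\<in>{1..n}. UNIV). \<Prod>a=1..n. c a (\<beta> a) * N a (\<beta> a) (y a) (z a))"
      by (subst prod_sum_PiE) auto
    finally show ?thesis using True by (simp add: tens_def prod.distrib)
  next
    case False
    then have 0: "tens n U K y z = 0" for K :: "nat \<Rightarrow> 'u \<Rightarrow> 'u \<Rightarrow> 'f"
      by (auto simp: tens_def)
    show ?thesis by (simp add: 0)
  qed
qed

text \<open>The parameter \<open>field_type\<close> pins down the type of scalars, on which the
  exceptional coordinates \<open>bad\<close> and hence the degree depend.\<close>

locale factorial_scheme =
  fixes n :: nat and U :: "nat \<Rightarrow> 'u set" and x :: "nat \<Rightarrow> 'u" and field_type :: "'f::field itself"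
  assumes U: "h \<in> {1..n} \<Longrightarrow> finite (U h) \<and> card (U h) \<ge> 2"
    and x: "x \<in> points n U"
begin

abbreviation Y where "Y \<equiv> points n U"
abbreviation MA :: "('f, (nat \<Rightarrow> 'u) \<Rightarrow> (nat \<Rightarrow> 'u) \<Rightarrow> 'f) module" where "MA \<equiv> matrix_algebra Y"
abbreviation span_Y where "span_Y S \<equiv> lin_span ring_of_type_algebra MA S"

lemma finU: "a \<in> {1..n} \<Longrightarrow> finite (U a)" using U by blast
lemma xU: "a \<in> {1..n} \<Longrightarrow> x a \<in> U a" using x by (auto simp: points_def PiE_def Pi_def)
lemma finY: "finite Y" using finU by (auto simp: points_def intro: finite_PiE)

sublocale MA: ring MA by (rule ring_matrix_algebra[OF finY])

definition bad :: "nat set" where "bad = {a \<in> {1..n}. of_nat (card (U a) - 1) = (0::'f)}"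

lemma finite_bad [simp]: "finite bad" and bad_le: "a \<in> bad \<Longrightarrow> a \<in> {1..n}"
  by (auto simp: bad_def)

definition deg :: "(nat \<Rightarrow> kind) \<Rightarrow> nat" where "deg \<beta> = (\<Sum>a\<in>bad. kind_deg (\<beta> a))"

definition basis :: "(nat \<Rightarrow> kind) \<Rightarrow> (nat \<Rightarrow> 'u) \<Rightarrow> (nat \<Rightarrow> 'u) \<Rightarrow> 'f"
  where "basis \<beta> = tens n U (\<lambda>a. loc (U a) (x a) (\<beta> a))"

definition basis_unit :: "(nat \<Rightarrow> kind) \<Rightarrow> (nat \<Rightarrow> 'u) \<Rightarrow> (nat \<Rightarrow> 'u) \<Rightarrow> 'f"
  where "basis_unit \<beta> = tens n U (\<lambda>a. loc_unit (U a) (x a) (\<beta> a))"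

text \<open>Level 0 will turn out to be the Terwilliger algebra and level 1 its radical.\<close>

definition filtration :: "nat \<Rightarrow> ((nat \<Rightarrow> 'u) \<Rightarrow> (nat \<Rightarrow> 'u) \<Rightarrow> 'f) set"
  where "filtration k = span_Y {basis \<beta> | \<beta>. k \<le> deg \<beta>}"

lemma basis_set_carrier: "{basis \<beta> | \<beta>. P \<beta>} \<subseteq> carrier MA"
  by (auto simp: basis_def tens_carrier)

lemma filtration_closed: "lin_closed (filtration k)"
  unfolding filtration_def by (rule lin_span_closed[OF finY basis_set_carrier])

lemma filtration_basis: "k \<le> deg \<beta> \<Longrightarrow> basis \<beta> \<in> filtration k"
  unfolding filtration_def
  by (rule subsetD[OF lin_span_superset[OF finY basis_set_carrier]]) blast

lemma filtration_least:
  assumes "lin_closed L" "\<And>\<beta>. k \<le> deg \<beta> \<Longrightarrow> basis \<beta> \<in> L"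
  shows "filtration k \<subseteq> L"
  unfolding filtration_def
  by (rule lin_span_least[OF finY basis_set_carrier assms(1)]) (use assms(2) in blast)

lemma lin_closed_carrier: "lin_closed (carrier MA)"
  by (auto simp: lin_closed_def matrix_algebra_def mat_add_def mat_scale_def mat_zero_def)

lemma filtration_carrier: "filtration k \<subseteq> carrier MA"
  by (rule filtration_least[OF lin_closed_carrier]) (simp add: basis_def tens_carrier)

lemma filtration_mono: "j \<le> k \<Longrightarrow> filtration k \<subseteq> filtration j"
  by (rule filtration_least[OF filtration_closed]) (auto intro: filtration_basis)

lemma deg_le: "deg \<beta> \<le> 2 * card bad"
proof -
  have "deg \<beta> \<le> (\<Sum>a\<in>bad. 2)" unfolding deg_def by (intro sum_mono kind_deg_le)
  then show ?thesis by simp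
qed

lemma basis_mul:
  "mat_mul Y (basis \<beta>) (basis \<gamma>) =
    mat_scale (\<Prod>a=1..n. kind_coef (of_nat (card (U a) - 1)) (\<beta> a) (\<gamma> a)) (basis (\<lambda>a. kind_mul (\<beta> a) (\<gamma> a)))"
proof -
  have "mat_mul Y (basis \<beta>) (basis \<gamma>) =
    tens n U (\<lambda>a. mat_mul (U a) (loc (U a) (x a) (\<beta> a)) (loc (U a) (x a) (\<gamma> a)))"
    unfolding basis_def by (rule tens_mul[OF finU])
  also have "\<dots> = tens n U (\<lambda>a. mat_scale (kind_coef (of_nat (card (U a) - 1)) (\<beta> a) (\<gamma> a))
      (loc (U a) (x a) (kind_mul (\<beta> a) (\<gamma> a))))"
    by (intro tens_cong mat_mul_loc finU xU)
  finally show ?thesis by (simp add: tens_scale basis_def)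
qed

text \<open>For basis matrices, a nonzero product has a nonzero local coefficient at each
  coordinate, so \<open>kind_deg_mul\<close> applies at each coordinate in
  \<open>bad\<close>.\<close>

lemma filtration_mul:
  assumes "M \<in> filtration j" "N \<in> filtration k"
  shows "mat_mul Y M N \<in> filtration (j + k)"
proof (rule lin_span_mat_mul[OF finY basis_set_carrier basis_set_carrier filtration_closed _
    assms[unfolded filtration_def]])
  fix M N assume "M \<in> {basis \<beta> | \<beta>. j \<le> deg \<beta>}" "N \<in> {basis \<beta> | \<beta>. k \<le> deg \<beta>}"
  then obtain \<beta> \<gamma> where *: "M = basis \<beta>" "j \<le> deg \<beta>" "N = basis \<gamma>" "k \<le> deg \<gamma>" by blast
  let ?c = "\<lambda>a. kind_coef (of_nat (card (U a) - 1) :: 'f) (\<beta> a) (\<gamma> a)"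
  let ?B = "basis (\<lambda>a. kind_mul (\<beta> a) (\<gamma> a))"
  show "mat_mul Y M N \<in> filtration (j + k)"
  proof (cases "(\<Prod>a=1..n. ?c a) = 0")
    case True
    then have "mat_mul Y M N = mat_zero" by (simp only: * basis_mul mat_scale_simps)
    then show ?thesis using filtration_closed by (simp add: lin_closed_def)
  next
    case False
    have "deg \<beta> + deg \<gamma> = (\<Sum>a\<in>bad. kind_deg (\<beta> a) + kind_deg (\<gamma> a))"
      by (simp add: deg_def sum.distrib)
    also have "\<dots> \<le> (\<Sum>a\<in>bad. kind_deg (kind_mul (\<beta> a) (\<gamma> a)))"
    proof (intro sum_mono kind_deg_mul)
      fix a assume a: "a \<in> bad"
      then have "?c a \<noteq> 0" using False bad_le by auto
      then show "kind_coef (0::'f) (\<beta> a) (\<gamma> a) \<noteq> 0" using a by (simp add: bad_def)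
    qed
    also have "\<dots> = deg (\<lambda>a. kind_mul (\<beta> a) (\<gamma> a))" by (simp add: deg_def)
    finally have "?B \<in> filtration (j + k)" using * by (intro filtration_basis) simp
    then show ?thesis using filtration_closed by (simp add: * basis_mul lin_closed_def)
  qed
qed

lemma filtration_vanish: "filtration (2 * card bad + 1) = {mat_zero}"
proof -
  have "\<not> 2 * card bad + 1 \<le> deg \<beta>" for \<beta> using deg_le[of \<beta>] by simp
  then have "filtration (2 * card bad + 1) \<subseteq> {mat_zero}"
    by (intro filtration_least) (auto simp: lin_closed_def mat_scale_simps)
  then show ?thesis using filtration_closed by (auto simp: lin_closed_def)
qed

lemma tens_in_filtration_0:
  assumes "\<And>a y z. a \<in> {1..n} \<Longrightarrow> y \<in> U a \<Longrightarrow> z \<in> U a \<Longrightarrow> M a y z = (\<Sum>k\<in>UNIV. c a k * loc (U a) (x a) k y z)"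
  shows "tens n U M \<in> filtration 0"
proof -
  have "tens n U M = (\<lambda>y z. \<Sum>\<beta>\<in>(\<Pi>\<^sub>E a\<in>{1..n}. UNIV). (\<Prod>a=1..n. c a (\<beta> a)) * basis \<beta> y z)"
    unfolding basis_def using assms by (rule tens_expand)
  also have "\<dots> \<in> filtration 0"
    by (rule lin_closed_sum[OF filtration_closed]) (auto intro: filtration_basis finite_PiE)
  finally show ?thesis .
qed

text \<open>At a coordinate in \<open>bad\<close> the two local bases coincide, so the change of basis preserves the degree.\<close>

lemma basis_unit_in_filtration: "k \<le> deg \<beta> \<Longrightarrow> basis_unit \<beta> \<in> filtration k"
proof -
  assume k: "k \<le> deg \<beta>"
  \<comment> \<open>The coefficients of \<open>loc_unit\<close> in terms of \<open>loc\<close>,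
    opposite to \<open>loc_coef\<close>.\<close>
  define d :: "nat \<Rightarrow> kind \<Rightarrow> 'f" where "d a k =
    (let m = of_nat (card (U a) - 1) in if m = 0 then of_bool (k = \<beta> a) else
      case \<beta> a of KC \<Rightarrow> of_bool (k = KC) / m | KJ \<Rightarrow> of_bool (k = KJ) / m
       | KI \<Rightarrow> (if k = KI then 1 else if k = KJ then - 1 / m else 0) | l \<Rightarrow> of_bool (k = l))" for a k
  have "loc_unit (U a) (x a) (\<beta> a) y z = (\<Sum>k\<in>UNIV. d a k * loc (U a) (x a) k y z)" for a y z
    by (cases "\<beta> a") (auto simp: d_def sum_kind loc_unit_def Let_def mat_scale_def mat_add_def)
  then have "basis_unit \<beta> = (\<lambda>y z. \<Sum>\<gamma>\<in>(\<Pi>\<^sub>E a\<in>{1..n}. UNIV). (\<Prod>a=1..n. d a (\<gamma> a)) * basis \<gamma> y z)"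
    unfolding basis_def basis_unit_def by (intro tens_expand)
  also have "\<dots> \<in> filtration k"
  proof (rule lin_closed_sum[OF filtration_closed])
    fix \<gamma> assume "(\<Prod>a=1..n. d a (\<gamma> a)) \<noteq> 0"
    then have nz: "d a (\<gamma> a) \<noteq> 0" if "a \<in> {1..n}" for a using that by auto
    have "\<gamma> a = \<beta> a" if "a \<in> bad" for a
      using nz[of a] that by (simp add: bad_def d_def)
    then have "deg \<gamma> = deg \<beta>" by (simp add: deg_def)
    then show "basis \<gamma> \<in> filtration k" using k by (intro filtration_basis) simp
  qed (auto intro: finite_PiE)
  finally show ?thesis .
qed

lemma filtration_0_basis_unit:
  assumes "M \<in> filtration 0"
  obtains c where "M = (\<lambda>y z. \<Sum>\<beta>\<in>(\<Pi>\<^sub>E a\<in>{1..n}. UNIV). c \<beta> * basis_unit \<beta> y z)"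
proof -
  define comb where "comb c = (\<lambda>y z. \<Sum>\<beta>\<in>(\<Pi>\<^sub>E a\<in>{1..n}. UNIV). c \<beta> * basis_unit \<beta> y z)" for c
  have "mat_add (comb c) (comb d) = comb (\<lambda>\<beta>. c \<beta> + d \<beta>)" for c d
    by (simp add: comb_def mat_add_def sum.distrib distrib_right)
  moreover have "mat_scale e (comb c) = comb (\<lambda>\<beta>. e * c \<beta>)" for e c
    by (simp add: comb_def mat_scale_def sum_distrib_left mult.assoc)
  moreover have "mat_zero = comb (\<lambda>\<beta>. 0)"
    by (simp add: comb_def mat_zero_def)
  ultimately have "lin_closed (range comb)"
    by (auto simp: lin_closed_def)
  moreover have "basis \<beta> = comb (\<lambda>\<gamma>. \<Prod>a=1..n. loc_coef (of_nat (card (U a) - 1)) (\<beta> a) (\<gamma> a))" for \<beta>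
    unfolding comb_def basis_def basis_unit_def by (intro tens_expand loc_expand)
  ultimately have "filtration 0 \<subseteq> range comb" by (intro filtration_least) auto
  then obtain c where "M = comb c" using assms by blast
  then show thesis unfolding comb_def by (rule that)
qed

end

section \<open>The Terwilliger algebra\<close>

lemma prod_of_bool: "finite A \<Longrightarrow> (\<Prod>a\<in>A. of_bool (P a)) = (of_bool (\<forall>a\<in>A. P a) :: 'f::field)"
  by (induction A rule: finite_induct) auto

text \<open>The complement of \<open>x\<close> is a single point. This is why \<open>triples\<close>
  restricts the common part of the supports to \<open>big_part\<close>.\<close>

lemma loc_KI_eq_KJ: "card V = 2 \<Longrightarrow> x \<in> V \<Longrightarrow> loc V x KI = (loc V x KJ :: _ \<Rightarrow> _ \<Rightarrow> 'f::field)"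
proof -
  assume "card V = 2" "x \<in> V"
  then obtain w where "V = {x, w}"
    by (auto simp: card_2_iff)
  then show ?thesis by (auto simp: loc_def fun_eq_iff)
qed

text \<open>\<open>g\<close> and \<open>i\<close> tell whether the row and the column point differ
  from the base point; \<open>h\<close> matters only if both do.\<close>

definition kind_of :: "nat \<Rightarrow> nat \<Rightarrow> nat \<Rightarrow> kind" where
  "kind_of g h i = (if g = 1 then (if i = 1 then (if h = 1 then KJ else KI) else KC)
     else (if i = 1 then KR else Ke))"

section \<open>The generators and the matrices \<open>B_mat\<close> as tensor products\<close>

context factorial_scheme begin

lemma adj_mat_tens: "adj_mat n U g = (tens n U (\<lambda>a y z. of_bool (y \<noteq> z \<longleftrightarrow> g a = 1)) :: _ \<Rightarrow> _ \<Rightarrow> 'f)"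
  by (auto simp: adj_mat_def tens_def fun_eq_iff prod_of_bool scheme_rel_def)

lemma dual_idem_tens:
  "dual_idem n U x g = (tens n U (\<lambda>a y z. of_bool (y = z \<and> (x a \<noteq> y \<longleftrightarrow> g a = 1))) :: _ \<Rightarrow> _ \<Rightarrow> 'f)"
proof (intro ext)
  fix y z
  have "y = z" if "y \<in> Y" "z \<in> Y" "\<forall>a\<in>{1..n}. y a = z a"
    using that unfolding points_def by (intro PiE_ext) auto
  then show "dual_idem n U x g y z = (tens n U (\<lambda>a y z. of_bool (y = z \<and> (x a \<noteq> y \<longleftrightarrow> g a = 1))) y z :: 'f)"
    using x by (auto simp: dual_idem_def tens_def prod_of_bool scheme_rel_def)
qed

text \<open>Locally, the relation of being distinct has matrix \<open>R + C + J - I\<close>, and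
  equality has \<open>e + I\<close>.\<close>

lemma adj_mat_in_filtration: "(adj_mat n U g :: _ \<Rightarrow> _ \<Rightarrow> 'f) \<in> filtration 0"
  unfolding adj_mat_tens
proof (rule tens_in_filtration_0)
  fix a y z assume "y \<in> U a" "z \<in> U a"
  then show "of_bool (y \<noteq> z \<longleftrightarrow> g a = 1) = (\<Sum>k\<in>UNIV. (if g a = 1 then
      (case k of KR \<Rightarrow> 1 | KC \<Rightarrow> 1 | KJ \<Rightarrow> 1 | KI \<Rightarrow> - 1 | Ke \<Rightarrow> 0) else of_bool (k = Ke \<or> k = KI))
      * (loc (U a) (x a) k y z :: 'f))"
    by (auto simp: sum_kind loc_def)
qed

lemma dual_idem_in_filtration: "(dual_idem n U x g :: _ \<Rightarrow> _ \<Rightarrow> 'f) \<in> filtration 0"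
  unfolding dual_idem_tens
proof (rule tens_in_filtration_0)
  fix a y z assume "y \<in> U a" "z \<in> U a"
  then show "of_bool (y = z \<and> (x a \<noteq> y \<longleftrightarrow> g a = 1)) = (\<Sum>k\<in>UNIV.
      of_bool (k = (if g a = 1 then KI else Ke)) * (loc (U a) (x a) k y z :: 'f))"
    by (auto simp: sum_kind loc_def)
qed

lemma one_in_filtration: "\<one>\<^bsub>MA\<^esub> \<in> filtration 0"
proof -
  have "y = z" if "y \<in> Y" "z \<in> Y" "\<forall>a\<in>{1..n}. y a = z a" for y z
    using that unfolding points_def by (intro PiE_ext) auto
  then have "\<one>\<^bsub>MA\<^esub> y z = adj_mat n U (\<lambda>a. 0) y z" for y z
    by (auto simp: matrix_algebra_def adj_mat_def scheme_rel_def)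
  then have "\<one>\<^bsub>MA\<^esub> = adj_mat n U (\<lambda>a. 0)" by (intro ext)
  then show ?thesis using adj_mat_in_filtration by simp
qed

lemma dual_adj_dual:
  "mat_mul Y (mat_mul Y (dual_idem n U x g) (adj_mat n U j)) (dual_idem n U x i) =
    (\<lambda>y z. of_bool ((x, y) \<in> scheme_rel n U g \<and> (y, z) \<in> scheme_rel n U j \<and> (x, z) \<in> scheme_rel n U i) :: 'f)"
proof (intro ext)
  fix y z
  have 1: "mat_mul Y (dual_idem n U x g) (adj_mat n U j) y w =
    (of_bool ((x, y) \<in> scheme_rel n U g \<and> (y, w) \<in> scheme_rel n U j) :: 'f)" for w
  proof -
    have "mat_mul Y (dual_idem n U x g) (adj_mat n U j) y w =
      (\<Sum>v\<in>Y. if v = y then of_bool ((x, y) \<in> scheme_rel n U g \<and> (y, w) \<in> scheme_rel n U j) else 0 :: 'f)"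
      unfolding mat_mul_def dual_idem_def adj_mat_def by (intro sum.cong) auto
    also have "\<dots> = of_bool ((x, y) \<in> scheme_rel n U g \<and> (y, w) \<in> scheme_rel n U j)"
      using finY by (auto simp: scheme_rel_def)
    finally show ?thesis .
  qed
  have "mat_mul Y (mat_mul Y (dual_idem n U x g) (adj_mat n U j)) (dual_idem n U x i) y z =
    (\<Sum>w\<in>Y. of_bool ((x, y) \<in> scheme_rel n U g \<and> (y, w) \<in> scheme_rel n U j) * dual_idem n U x i w z :: 'f)"
    by (subst mat_mul_def) (simp add: 1)
  also have "\<dots> = (\<Sum>w\<in>Y. if w = z
      then of_bool ((x, y) \<in> scheme_rel n U g \<and> (y, z) \<in> scheme_rel n U j \<and> (x, z) \<in> scheme_rel n U i) else 0)"
    unfolding dual_idem_def by (intro sum.cong) auto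
  also have "\<dots> = of_bool ((x, y) \<in> scheme_rel n U g \<and> (y, z) \<in> scheme_rel n U j \<and> (x, z) \<in> scheme_rel n U i)"
    using finY by (auto simp: scheme_rel_def)
  finally show "mat_mul Y (mat_mul Y (dual_idem n U x g) (adj_mat n U j)) (dual_idem n U x i) y z =
    (of_bool ((x, y) \<in> scheme_rel n U g \<and> (y, z) \<in> scheme_rel n U j \<and> (x, z) \<in> scheme_rel n U i) :: 'f)" .
qed

lemma finite_bit_vectors: "finite (bit_vectors n)"
  by (auto simp: bit_vectors_def intro: finite_PiE)

lemma B_mat_sum:
  "B_mat n U x g h i = (\<lambda>y z. \<Sum>j | j \<in> bit_vectors n \<and> sym_diff (supp n g) (supp n i) \<subseteq> supp n j \<and> supp n j \<subseteq> supp n h.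
     (mat_mul Y (mat_mul Y (dual_idem n U x g) (adj_mat n U j)) (dual_idem n U x i) y z :: 'f))"
  unfolding B_mat_def matrix_algebra_simps
  by (rule finsum_matrix_algebra[OF finY])
    (auto simp: finite_bit_vectors dual_adj_dual matrix_algebra_def scheme_rel_def)

text \<open>Each pair of points lies in exactly one relation, so the defining sum has at most one
  nonzero term at each entry. The bounds on its index become independent conditions on the
  coordinates, which makes the matrix a tensor product.\<close>

lemma B_mat_eq_basis:
  assumes t: "(g, h, i) \<in> triples n U"
  shows "B_mat n U x g h i = basis (\<lambda>a. kind_of (g a) (h a) (i a))"
proof (intro ext)
  fix y z
  let ?J = "{j. j \<in> bit_vectors n \<and> sym_diff (supp n g) (supp n i) \<subseteq> supp n j \<and> supp n j \<subseteq> supp n h}"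
  show "B_mat n U x g h i y z = basis (\<lambda>a. kind_of (g a) (h a) (i a)) y z"
  proof (cases "y \<in> Y \<and> z \<in> Y")
    case True
    let ?P = "(x, y) \<in> scheme_rel n U g \<and> (x, z) \<in> scheme_rel n U i"
    define j0 :: "nat \<Rightarrow> nat" where "j0 = (\<lambda>a\<in>{1..n}. if y a \<noteq> z a then 1 else 0)"
    have j0: "(y, z) \<in> scheme_rel n U j \<longleftrightarrow> j = j0" if "j \<in> bit_vectors n" for j
    proof
      assume "(y, z) \<in> scheme_rel n U j"
      then have "j a = j0 a" if "a \<in> {1..n}" for a
        using \<open>j \<in> bit_vectors n\<close> that
        by (auto simp: scheme_rel_def j0_def bit_vectors_def PiE_def Pi_def split: if_splits)
      then show "j = j0" using that unfolding bit_vectors_def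
        by (intro PiE_ext[of j _ "\<lambda>_. {0,1}"]) (auto simp: j0_def)
    qed (use True in \<open>auto simp: scheme_rel_def j0_def\<close>)
    have j0b: "j0 \<in> bit_vectors n" by (auto simp: j0_def bit_vectors_def)
    have "B_mat n U x g h i y z = (\<Sum>j\<in>?J. if j = j0 then of_bool ?P else 0 :: 'f)"
      unfolding B_mat_sum dual_adj_dual by (intro sum.cong) (auto simp: j0)
    also have "\<dots> = of_bool (?P \<and> j0 \<in> ?J)"
      using finite_bit_vectors by auto
    also have "(?P \<and> j0 \<in> ?J) \<longleftrightarrow> (\<forall>a\<in>{1..n}. (x a \<noteq> y a \<longleftrightarrow> g a = 1) \<and> (x a \<noteq> z a \<longleftrightarrow> i a = 1)
        \<and> ((g a = 1) \<noteq> (i a = 1) \<longrightarrow> y a \<noteq> z a) \<and> (y a \<noteq> z a \<longrightarrow> h a = 1))"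
      using True x j0b by (auto simp: scheme_rel_def supp_def j0_def split: if_splits)
    also have "\<dots> \<longleftrightarrow> (\<forall>a\<in>{1..n}. kind_rel (x a) (kind_of (g a) (h a) (i a)) (y a) (z a))"
    proof (intro ball_cong refl)
      fix a assume "a \<in> {1..n}"
      \<comment> \<open>In the mixed cases \<open>kind_of\<close> does not look at \<open>h\<close>;
        membership in \<open>triples\<close> supplies the value that the upper bound
        requires.\<close>
      then have "(g a = 1) \<noteq> (i a = 1) \<longrightarrow> h a = 1" using t by (auto simp: triples_def supp_def)
      then show "((x a \<noteq> y a \<longleftrightarrow> g a = 1) \<and> (x a \<noteq> z a \<longleftrightarrow> i a = 1)
        \<and> ((g a = 1) \<noteq> (i a = 1) \<longrightarrow> y a \<noteq> z a) \<and> (y a \<noteq> z a \<longrightarrow> h a = 1))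
        \<longleftrightarrow> kind_rel (x a) (kind_of (g a) (h a) (i a)) (y a) (z a)"
        by (auto simp: kind_of_def)
    qed
    also have "of_bool \<dots> = basis (\<lambda>a. kind_of (g a) (h a) (i a)) y z"
    proof -
      have "y a \<in> U a" "z a \<in> U a" if "a \<in> {1..n}" for a
        using that True by (auto simp: points_def PiE_def Pi_def)
      then show ?thesis using True by (auto simp: basis_def tens_def loc_def prod_of_bool)
    qed
    finally show ?thesis .
  next
    case False
    then have "(y, z) \<notin> scheme_rel n U j" for j by (auto simp: scheme_rel_def)
    then show ?thesis using False unfolding B_mat_sum dual_adj_dual by (auto simp: basis_def tens_def)
  qed
qed

lemma deg_pos_iff: "1 \<le> deg \<beta> \<longleftrightarrow> (\<exists>a\<in>bad. kind_deg (\<beta> a) \<noteq> 0)"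
  unfolding deg_def by (auto simp: Suc_le_eq sum_pos2 simp flip: neq0_conv)

text \<open>The valency is a product over the support of \<open>h\<close>, so it vanishes exactly if
  this support meets \<open>bad\<close>. Membership in \<open>triples\<close> makes
  \<open>h a = 1\<close> equivalent to positive local degree there.\<close>

lemma valency_zero_iff:
  assumes t: "(g, h, i) \<in> triples n U"
  shows "of_nat (valency n U h) = (0::'f) \<longleftrightarrow> 1 \<le> deg (\<lambda>a. kind_of (g a) (h a) (i a))"
proof -
  have "of_nat (valency n U h) = (0::'f) \<longleftrightarrow> (\<exists>a\<in>bad. h a = 1)"
    by (auto simp: valency_def of_nat_prod supp_def bad_def)
  moreover have "h a = 1 \<longleftrightarrow> kind_deg (kind_of (g a) (h a) (i a)) \<noteq> 0" if "a \<in> bad" for a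
    using t bad_le[OF that] by (auto simp: triples_def supp_def kind_of_def big_part_def)
  ultimately show ?thesis unfolding deg_pos_iff by blast
qed

text \<open>The triple is read off from \<beta> by inverting \<open>kind_of\<close>, except that
  \<open>KJ\<close> becomes \<open>KI\<close> where \<open>U a\<close> has two elements. There the
  two matrices agree, and no such coordinate lies in \<open>bad\<close>, so the degree is
  unchanged.\<close>

lemma basis_eq_B_mat:
  obtains g h i where "(g, h, i) \<in> triples n U" "B_mat n U x g h i = basis \<beta>"
    "deg (\<lambda>a. kind_of (g a) (h a) (i a)) = deg \<beta>"
proof -
  define g :: "nat \<Rightarrow> nat" where "g = (\<lambda>a\<in>{1..n}. of_bool (\<beta> a \<in> {KC, KI, KJ}))"
  define i :: "nat \<Rightarrow> nat" where "i = (\<lambda>a\<in>{1..n}. of_bool (\<beta> a \<in> {KR, KI, KJ}))"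
  define h :: "nat \<Rightarrow> nat" where "h = (\<lambda>a\<in>{1..n}. of_bool (\<beta> a \<in> {KR, KC} \<or> \<beta> a = KJ \<and> card (U a) > 2))"
  have bits: "g \<in> bit_vectors n" "h \<in> bit_vectors n" "i \<in> bit_vectors n"
    by (auto simp: g_def h_def i_def bit_vectors_def)
  have t: "(g, h, i) \<in> triples n U"
  proof -
    have "supp n g = {a \<in> {1..n}. \<beta> a \<in> {KC, KI, KJ}}" "supp n i = {a \<in> {1..n}. \<beta> a \<in> {KR, KI, KJ}}"
      "supp n h = {a \<in> {1..n}. \<beta> a \<in> {KR, KC} \<or> \<beta> a = KJ \<and> card (U a) > 2}"
      by (auto simp: supp_def g_def h_def i_def)
    then show ?thesis using bits by (auto simp: triples_def big_part_def)
  qed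
  have k: "kind_of (g a) (h a) (i a) = (if \<beta> a = KJ \<and> \<not> card (U a) > 2 then KI else \<beta> a)" if "a \<in> {1..n}" for a
    using that by (cases "\<beta> a") (auto simp: kind_of_def g_def h_def i_def)
  have "loc (U a) (x a) (kind_of (g a) (h a) (i a)) = (loc (U a) (x a) (\<beta> a) :: _ \<Rightarrow> _ \<Rightarrow> 'f)" if "a \<in> {1..n}" for a
    unfolding k[OF that] using U[OF that] xU[OF that] by (auto intro!: loc_KI_eq_KJ)
  then have "B_mat n U x g h i = basis \<beta>"
    unfolding B_mat_eq_basis[OF t] unfolding basis_def by (intro tens_cong)
  moreover have "deg (\<lambda>a. kind_of (g a) (h a) (i a)) = deg \<beta>"
    unfolding deg_def
  proof (intro sum.cong refl)
    fix a assume a: "a \<in> bad"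
    \<comment> \<open>Two elements would give \<open>m = 1\<close>, which is nonzero in a
      field.\<close>
    have "card (U a) \<noteq> 2" using a by (auto simp: bad_def)
    then have "card (U a) > 2" using U[OF bad_le[OF a]] by simp
    then show "kind_deg (kind_of (g a) (h a) (i a)) = kind_deg (\<beta> a)"
      using k[OF bad_le[OF a]] by simp
  qed
  ultimately show thesis using that t by blast
qed

lemma radical_span_eq: "radical_span n U x = filtration 1"
proof -
  have "{B_mat n U x a b c | a b c. (a, b, c) \<in> triples n U \<and> of_nat (valency n U b) = (0::'f)}
     = {basis \<beta> | \<beta>. 1 \<le> deg \<beta>}"
  proof (intro subset_antisym subsetI)
    fix M :: "(nat \<Rightarrow> 'u) \<Rightarrow> (nat \<Rightarrow> 'u) \<Rightarrow> 'f"
    assume "M \<in> {B_mat n U x a b c | a b c. (a, b, c) \<in> triples n U \<and> of_nat (valency n U b) = (0::'f)}"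
    then show "M \<in> {basis \<beta> | \<beta>. 1 \<le> deg \<beta>}"
      using valency_zero_iff B_mat_eq_basis by blast
  next
    fix M assume "M \<in> {basis \<beta> | \<beta>. 1 \<le> deg \<beta>}"
    then obtain \<beta> where \<beta>: "M = basis \<beta>" "1 \<le> deg \<beta>" by blast
    obtain g h i where "(g, h, i) \<in> triples n U" "B_mat n U x g h i = basis \<beta>"
      "deg (\<lambda>a. kind_of (g a) (h a) (i a)) = deg \<beta>" by (rule basis_eq_B_mat)
    with \<beta> valency_zero_iff
    show "M \<in> {B_mat n U x a b c | a b c. (a, b, c) \<in> triples n U \<and> of_nat (valency n U b) = (0::'f)}"
      by (metis (mono_tags, lifting) mem_Collect_eq)
  qed
  then show ?thesis by (simp add: radical_span_def filtration_def)
qed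

section \<open>The generated subalgebra and its filtration by ideals\<close>

lemma submodule_filtration: "submodule (filtration k) ring_of_type_algebra MA"
  by (rule lin_closed_submodule[OF finY filtration_carrier filtration_closed])

lemma filtration_neg: "M \<in> filtration k \<Longrightarrow> \<ominus>\<^bsub>MA\<^esub> M \<in> filtration k"
  using module.submoduleE(3)[OF module_matrix_algebra[OF finY] submodule_filtration] by blast

lemma subring_filtration: "subring (filtration 0) MA"
proof (rule MA.subringI)
  show "M \<otimes>\<^bsub>MA\<^esub> N \<in> filtration 0" if "M \<in> filtration 0" "N \<in> filtration 0" for M N
    using filtration_mul[OF that] by simp
  show "M \<oplus>\<^bsub>MA\<^esub> N \<in> filtration 0" if "M \<in> filtration 0" "N \<in> filtration 0" for M N
    using filtration_closed that by (simp add: lin_closed_def)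
qed (use filtration_carrier one_in_filtration filtration_neg in auto)

text \<open>Level 0 is a subalgebra containing the generators. Conversely, every basis matrix is
  some \<open>B_mat\<close>, which is a sum of products of generators.\<close>

lemma gen_subalgebra_eq:
  "gen_subalgebra ring_of_type_algebra MA (adj_mat n U ` bit_vectors n \<union> dual_idem n U x ` bit_vectors n)
    = filtration 0"
proof (rule subset_antisym)
  show "gen_subalgebra ring_of_type_algebra MA (adj_mat n U ` bit_vectors n \<union> dual_idem n U x ` bit_vectors n)
    \<subseteq> filtration 0"
    unfolding gen_subalgebra_def
    by (rule Inter_lower)
      (auto simp: subring_filtration submodule_filtration adj_mat_in_filtration dual_idem_in_filtration)
next
  have "filtration 0 \<subseteq> H" if H: "subring H MA" "submodule H ring_of_type_algebra MA"
    "adj_mat n U ` bit_vectors n \<union> dual_idem n U x ` bit_vectors n \<subseteq> H" for H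
  proof (rule filtration_least)
    show lc: "lin_closed H" by (rule submodule_lin_closed[OF finY H(2)])
    fix \<beta>
    obtain g h i where t: "(g, h, i) \<in> triples n U" and B: "B_mat n U x g h i = basis \<beta>"
      by (rule basis_eq_B_mat)
    have gi: "g \<in> bit_vectors n" "i \<in> bit_vectors n" using t by (auto simp: triples_def)
    have mul: "mat_mul Y M N \<in> H" if "M \<in> H" "N \<in> H" for M N
      using subringE(6)[OF H(1)] that by simp
    let ?J = "{j. j \<in> bit_vectors n \<and> sym_diff (supp n g) (supp n i) \<subseteq> supp n j \<and> supp n j \<subseteq> supp n h}"
    have "(\<lambda>y z. \<Sum>j\<in>?J. 1 * mat_mul Y (mat_mul Y (dual_idem n U x g) (adj_mat n U j)) (dual_idem n U x i) y z) \<in> H"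
      using H(3) gi finite_bit_vectors by (intro lin_closed_sum[OF lc]) (auto intro!: mul)
    then have "B_mat n U x g h i \<in> H" by (simp add: B_mat_sum)
    then show "basis \<beta> \<in> H" by (simp add: B)
  qed
  then show "filtration 0 \<subseteq> gen_subalgebra ring_of_type_algebra MA
    (adj_mat n U ` bit_vectors n \<union> dual_idem n U x ` bit_vectors n)"
    unfolding gen_subalgebra_def by blast
qed

abbreviation TA :: "('f, (nat \<Rightarrow> 'u) \<Rightarrow> (nat \<Rightarrow> 'u) \<Rightarrow> 'f) module" where "TA \<equiv> MA\<lparr>carrier := filtration 0\<rparr>"

lemma terwilliger_algebra_eq: "terwilliger_algebra n U x = TA"
  by (simp add: terwilliger_algebra_def gen_subalgebra_eq)

sublocale TA: ring TA by (rule MA.subring_is_ring[OF subring_filtration])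

lemma ideal_filtration: "ideal (filtration k) TA"
proof (rule idealI)
  show "ring TA" by (rule TA.ring_axioms)
  show "subgroup (filtration k) (add_monoid TA)"
  proof (rule TA.add.subgroupI)
    show "filtration k \<subseteq> carrier TA" using filtration_mono[of 0 k] by simp
    show "filtration k \<noteq> {}" using filtration_closed[of k] by (auto simp: lin_closed_def)
    fix M assume M: "M \<in> filtration k"
    then have c: "mat_scale (-1) M \<in> filtration k" using filtration_closed by (auto simp: lin_closed_def)
    have "\<ominus>\<^bsub>TA\<^esub> M = mat_scale (-1) M"
      using M c filtration_mono[of 0 k]
      by (intro TA.minus_equality) (auto simp: mat_add_def mat_scale_def mat_zero_def)
    then show "\<ominus>\<^bsub>TA\<^esub> M \<in> filtration k" using c by simp
  next
    fix M N assume "M \<in> filtration k" "N \<in> filtration k"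
    then show "M \<oplus>\<^bsub>TA\<^esub> N \<in> filtration k" using filtration_closed by (auto simp: lin_closed_def)
  qed
  show "r \<otimes>\<^bsub>TA\<^esub> M \<in> filtration k" "M \<otimes>\<^bsub>TA\<^esub> r \<in> filtration k" if "M \<in> filtration k" "r \<in> carrier TA" for r M
    using filtration_mul[of r 0 M k] filtration_mul[of M k r 0] that by auto
qed

section \<open>The nilpotent index\<close>

lemma foldr_in_filtration:
  "set Ms \<subseteq> filtration 1 \<Longrightarrow> foldr (mat_mul Y) Ms \<one>\<^bsub>MA\<^esub> \<in> filtration (length Ms)"
proof (induction Ms)
  case Nil
  then show ?case using one_in_filtration by simp
next
  case (Cons M Ms)
  then show ?case using filtration_mul[of M 1 _ "length Ms"] by simp
qed

lemma products_vanish_filtration: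
  assumes "m \<ge> 2 * card bad + 1"
  shows "products_vanish TA (filtration 1) m"
  using foldr_in_filtration filtration_mono[OF assms] filtration_vanish
  by (fastforce simp: products_vanish_def)

lemma nilpotent_ideal_filtration: "nilpotent_ideal (filtration 1) TA"
  unfolding nilpotent_ideal_def
  using ideal_filtration products_vanish_filtration[of "2 * card bad + 1"] by auto

text \<open>Two factors of degree one are spent on each coordinate \<open>b\<close> in
  \<open>bad\<close>: a column and a row at \<open>b\<close>, with \<open>CR = J\<close>. All pairs
  together give \<open>J\<close> at every coordinate in \<open>bad\<close>, which is
  nonzero.\<close>

lemma not_products_vanish_filtration:
  assumes "m \<le> 2 * card bad"
  shows "\<not> products_vanish TA (filtration 1) m"
proof -
  define J where "J S a = (if a \<in> S then KJ else if a \<in> bad then KI else Ke)" for S :: "nat set" and a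
  define put where "put b k a = (if a = b then k else if a \<in> bad then KI else Ke)" for b :: nat and k and a
  have step: "mat_mul Y (basis (put b KC)) (mat_mul Y (basis (put b KR)) (basis (J S))) = basis (J (insert b S))"
    if "b \<in> bad" "b \<notin> S" "S \<subseteq> bad" for b S
  proof -
    have 1: "(\<Prod>a=1..n. kind_coef (of_nat (card (U a) - 1)) (put b KR a) (J S a)) = (1::'f)"
      using that by (intro prod.neutral) (auto simp: put_def J_def)
    have 2: "(\<Prod>a=1..n. kind_coef (of_nat (card (U a) - 1)) (put b KC a) (kind_mul (put b KR a) (J S a))) = (1::'f)"
      using that by (intro prod.neutral) (auto simp: put_def J_def)
    have 3: "(\<lambda>a. kind_mul (put b KC a) (kind_mul (put b KR a) (J S a))) = J (insert b S)"
      using that by (auto simp: put_def J_def fun_eq_iff)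
    show ?thesis
      by (simp only: basis_mul 1 mat_scale_simps 2 3)
  qed
  have put: "basis (put b k) \<in> filtration 1" if "b \<in> bad" "k = KC \<or> k = KR" for b k
    using that by (intro filtration_basis, unfold deg_pos_iff) (auto simp: put_def intro!: bexI[of _ b])
  define Ms where "Ms bs = concat (map (\<lambda>b. [basis (put b KC), basis (put b KR)]) bs)" for bs
  \<comment> \<open>The unit at the end of \<open>foldr\<close> is absorbed by
    \<open>basis (J {})\<close>, so that every step multiplies single basis matrices.\<close>
  have Ms: "mat_mul Y (foldr (mat_mul Y) (Ms bs) \<one>\<^bsub>MA\<^esub>) (basis (J {})) = basis (J (set bs))
      \<and> set (Ms bs) \<subseteq> filtration 1 \<and> length (Ms bs) = 2 * length bs"
    if "distinct bs" "set bs \<subseteq> bad" for bs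
    using that
  proof (induction bs)
    case Nil
    have "\<one>\<^bsub>MA\<^esub> \<otimes>\<^bsub>MA\<^esub> basis (J {}) = basis (J {})"
      by (intro MA.l_one) (simp add: basis_def tens_carrier)
    then show ?case by (simp add: Ms_def)
  next
    case (Cons b bs)
    then show ?case using step[of b "set bs"] put by (simp add: Ms_def mat_mul_assoc)
  qed
  have ne: "basis (J bad) \<noteq> mat_zero"
  proof -
    have "\<exists>v. v \<in> U a \<and> v \<noteq> x a" if "a \<in> {1..n}" for a
    proof (rule ccontr)
      assume "\<nexists>v. v \<in> U a \<and> v \<noteq> x a"
      then have "U a \<subseteq> {x a}" by blast
      then have "card (U a) \<le> 1" using card_mono[of "{x a}" "U a"] by simp
      then show False using U[OF that] by simp
    qed
    then obtain v where v: "\<And>a. a \<in> {1..n} \<Longrightarrow> v a \<in> U a \<and> v a \<noteq> x a" by metis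
    \<comment> \<open>A point differing from \<open>x\<close> exactly at the coordinates in
      \<open>bad\<close>; every local factor has diagonal entry 1 there.\<close>
    define y where "y = (\<lambda>a\<in>{1..n}. if a \<in> bad then v a else x a)"
    have yY: "y \<in> Y" using v xU by (auto simp: y_def points_def)
    have "loc (U a) (x a) (J bad a) (y a) (y a) = (1::'f)" if "a \<in> {1..n}" for a
      using that v[OF that] xU[OF that] by (auto simp: y_def loc_def J_def)
    then have "basis (J bad) y y = 1" using yY by (simp add: basis_def tens_def)
    then show ?thesis by (auto simp: mat_zero_def)
  qed
  obtain bs where bs: "set bs = bad" "distinct bs" using finite_distinct_list[OF finite_bad] by blast
  have lb: "length (Ms bs) = 2 * card bad" using Ms[of bs] bs distinct_card[of bs] by simp
  show ?thesis
  proof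
    assume "products_vanish TA (filtration 1) m"
    \<comment> \<open>The list has \<open>2 * card bad\<close> factors; if its first
      \<open>m\<close> multiply to zero, so does the whole list.\<close>
    moreover have "length (take m (Ms bs)) = m" "set (take m (Ms bs)) \<subseteq> filtration 1"
      using Ms[of bs] bs lb assms set_take_subset[of m "Ms bs"] by auto
    ultimately have z: "foldr (mat_mul Y) (take m (Ms bs)) \<one>\<^bsub>MA\<^esub> = mat_zero"
      by (simp add: products_vanish_def)
    have split: "foldr (mat_mul Y) (As @ Bs) \<one>\<^bsub>MA\<^esub> =
        mat_mul Y (foldr (mat_mul Y) As \<one>\<^bsub>MA\<^esub>) (foldr (mat_mul Y) Bs \<one>\<^bsub>MA\<^esub>)"
      if "set Bs \<subseteq> filtration 1" for As Bs
    proof (induction As)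
      case Nil
      have "\<one>\<^bsub>MA\<^esub> \<otimes>\<^bsub>MA\<^esub> foldr (mat_mul Y) Bs \<one>\<^bsub>MA\<^esub> = foldr (mat_mul Y) Bs \<one>\<^bsub>MA\<^esub>"
        using foldr_in_filtration[OF that] filtration_carrier by (intro MA.l_one) blast
      then show ?case by simp
    qed (simp add: mat_mul_assoc)
    have "set (drop m (Ms bs)) \<subseteq> filtration 1"
      using Ms[of bs] bs set_drop_subset[of m "Ms bs"] by auto
    from split[OF this, of "take m (Ms bs)"] have "foldr (mat_mul Y) (Ms bs) \<one>\<^bsub>MA\<^esub> = mat_zero"
      by (simp add: z mat_mul_linear)
    then show False using Ms[of bs] bs ne by (simp add: mat_mul_linear)
  qed
qed

lemma nilpotent_index_filtration: "nilpotent_index (filtration 1) TA = 2 * card bad + 1"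
  unfolding nilpotent_index_def
proof (rule Least_equality)
  show "2 * card bad + 1 \<ge> 1 \<and> products_vanish TA (filtration 1) (2 * card bad + 1)"
    using products_vanish_filtration by simp
  fix m assume "m \<ge> 1 \<and> products_vanish TA (filtration 1) m"
  then show "2 * card bad + 1 \<le> m" using not_products_vanish_filtration[of m] by linarith
qed

end

section \<open>The radical is contained in the part of positive degree\<close>

lemma mat_mul_sum:
  "mat_mul Y (\<lambda>y z. \<Sum>v\<in>A. c v * f v y z) N = (\<lambda>y z. \<Sum>v\<in>A. c v * mat_mul Y (f v) N y z)"
  "mat_mul Y N (\<lambda>y z. \<Sum>v\<in>A. c v * f v y z) = (\<lambda>y z. \<Sum>v\<in>A. c v * mat_mul Y N (f v) y z)"
proof -
  have "(\<Sum>w\<in>Y. (\<Sum>v\<in>A. c v * f v y w) * N w z) = (\<Sum>v\<in>A. c v * (\<Sum>w\<in>Y. f v y w * N w z))" for y z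
    by (simp add: sum_distrib_left sum_distrib_right mult.assoc) (rule sum.swap)
  then show "mat_mul Y (\<lambda>y z. \<Sum>v\<in>A. c v * f v y z) N = (\<lambda>y z. \<Sum>v\<in>A. c v * mat_mul Y (f v) N y z)"
    by (simp add: mat_mul_def)
  have "(\<Sum>w\<in>Y. N y w * (\<Sum>v\<in>A. c v * f v w z)) = (\<Sum>v\<in>A. c v * (\<Sum>w\<in>Y. N y w * f v w z))" for y z
    by (simp add: sum_distrib_left mult.left_commute) (rule sum.swap)
  then show "mat_mul Y N (\<lambda>y z. \<Sum>v\<in>A. c v * f v y z) = (\<lambda>y z. \<Sum>v\<in>A. c v * mat_mul Y N (f v) y z)"
    by (simp add: mat_mul_def)
qed

context factorial_scheme begin

lemma tens_mul_Y: "mat_mul Y (tens n U M) (tens n U N) = tens n U (\<lambda>a. mat_mul (U a) (M a) (N a))"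
  by (rule tens_mul) (rule finU)

lemma basis_unit_sandwich:
  assumes "deg \<beta> = 0" "deg \<gamma> = 0"
  shows "mat_mul Y (mat_mul Y (basis_unit (\<lambda>a. kind_lft (\<beta> a))) (basis_unit \<gamma>)) (basis_unit (\<lambda>a. kind_rgt (\<beta> a)))
    = mat_scale (of_bool (\<forall>a\<in>{1..n}. \<beta> a = \<gamma> a)) (basis_unit (\<lambda>a. kind_core (\<beta> a)))"
proof -
  have 0: "of_nat (card (U a) - 1) = (0::'f) \<Longrightarrow> kind_deg (\<beta> a) = 0 \<and> kind_deg (\<gamma> a) = 0" if "a \<in> {1..n}" for a
    using assms that deg_pos_iff[of \<beta>] deg_pos_iff[of \<gamma>] by (auto simp: bad_def)
  have "tens n U (\<lambda>a. mat_mul (U a) (mat_mul (U a) (loc_unit (U a) (x a) (kind_lft (\<beta> a))) (loc_unit (U a) (x a) (\<gamma> a)))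
      (loc_unit (U a) (x a) (kind_rgt (\<beta> a)))) =
    tens n U (\<lambda>a. mat_scale (of_bool (\<beta> a = \<gamma> a)) (loc_unit (U a) (x a) (kind_core (\<beta> a)) :: _ \<Rightarrow> _ \<Rightarrow> 'f))"
    by (intro tens_cong loc_unit_sandwich finU xU 0)
  then show ?thesis
    by (simp only: basis_unit_def tens_mul_Y tens_scale prod_of_bool finite_atLeastAtMost)
qed

lemma basis_unit_recover:
  "mat_mul Y (mat_mul Y (basis_unit (\<lambda>a. kind_row (\<beta> a))) (basis_unit (\<lambda>a. kind_core (\<beta> a)))) (basis_unit (\<lambda>a. kind_col (\<beta> a)))
    = basis_unit \<beta>"
proof -
  have "tens n U (\<lambda>a. mat_mul (U a) (mat_mul (U a) (loc_unit (U a) (x a) (kind_row (\<beta> a))) (loc_unit (U a) (x a) (kind_core (\<beta> a))))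
      (loc_unit (U a) (x a) (kind_col (\<beta> a)))) =
    tens n U (\<lambda>a. loc_unit (U a) (x a) (\<beta> a) :: _ \<Rightarrow> _ \<Rightarrow> 'f)"
    by (intro tens_cong loc_unit_recover finU xU)
  then show ?thesis by (simp only: basis_unit_def tens_mul_Y)
qed

lemma basis_unit_core_idem:
  "mat_mul Y (basis_unit (\<lambda>a. kind_core (\<beta> a))) (basis_unit (\<lambda>a. kind_core (\<beta> a)))
    = basis_unit (\<lambda>a. kind_core (\<beta> a))"
proof -
  have "tens n U (\<lambda>a. mat_mul (U a) (loc_unit (U a) (x a) (kind_core (\<beta> a))) (loc_unit (U a) (x a) (kind_core (\<beta> a)))) =
    tens n U (\<lambda>a. loc_unit (U a) (x a) (kind_core (\<beta> a)) :: _ \<Rightarrow> _ \<Rightarrow> 'f)"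
    by (intro tens_cong loc_unit_core_idem finU xU)
  then show ?thesis by (simp only: basis_unit_def tens_mul_Y)
qed

text \<open>Each term with a nonzero coefficient is shown to lie in level 1. In degree zero the
  outcome is that the basis matrix itself is zero, not a contradiction, because
  \<open>basis_unit\<close> can vanish at coordinates with two points.\<close>

lemma jacobson_radical_le_filtration: "jacobson_radical TA \<subseteq> filtration 1"
proof
  fix M assume M: "M \<in> jacobson_radical TA"
  then have "M \<in> filtration 0" by (simp add: jacobson_radical_def)
  then obtain c where Mc: "M = (\<lambda>y z. \<Sum>\<beta>\<in>(\<Pi>\<^sub>E a\<in>{1..n}. UNIV). c \<beta> * basis_unit \<beta> y z)"
    by (rule filtration_0_basis_unit)
  let ?K = "\<Pi>\<^sub>E a\<in>{1..n}. UNIV :: kind set"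
  have finK: "finite ?K" by (auto intro: finite_PiE)
  have "basis_unit \<beta> \<in> filtration 1" if \<beta>: "\<beta> \<in> ?K" "c \<beta> \<noteq> 0" for \<beta>
  proof (cases "deg \<beta> = 0")
    case False
    then show ?thesis by (intro basis_unit_in_filtration) simp
  next
    case True
    let ?l = "basis_unit (\<lambda>a. kind_lft (\<beta> a))" and ?t = "basis_unit (\<lambda>a. kind_rgt (\<beta> a))"
      and ?e = "basis_unit (\<lambda>a. kind_core (\<beta> a))"
    \<comment> \<open>The scalar \<open>1 / c \<beta>\<close> normalises the extracted term to the
      idempotent \<open>?e\<close>.\<close>
    define s where "s = mat_scale (1 / c \<beta>) ?l"
    define N where "N \<gamma> = mat_mul Y (mat_mul Y s (basis_unit \<gamma>)) ?t" for \<gamma>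
    define R where "R = (\<lambda>y z. \<Sum>\<gamma>\<in>?K - {\<beta>}. c \<gamma> * N \<gamma> y z)"
    have bu: "basis_unit \<gamma> \<in> filtration 0" for \<gamma> by (intro basis_unit_in_filtration) simp
    have s: "s \<in> filtration 0" unfolding s_def using bu filtration_closed by (auto simp: lin_closed_def)
    have N0: "N \<gamma> = mat_scale (1 / c \<beta>) (mat_scale (of_bool (\<forall>a\<in>{1..n}. \<beta> a = \<gamma> a)) ?e)"
      if "deg \<gamma> = 0" for \<gamma>
      using basis_unit_sandwich[OF True that] by (simp add: N_def s_def mat_mul_linear)
    have N\<beta>: "N \<beta> = mat_scale (1 / c \<beta>) ?e" using N0[OF True] by (simp add: mat_scale_simps)
    \<comment> \<open>Other terms of degree zero are annihilated by the sandwich; those of positive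
      degree stay in the ideal.\<close>
    have "N \<gamma> \<in> filtration 1" if \<gamma>: "\<gamma> \<in> ?K - {\<beta>}" for \<gamma>
    proof (cases "deg \<gamma> = 0")
      case True
      have "\<not> (\<forall>a\<in>{1..n}. \<beta> a = \<gamma> a)"
        using \<gamma> \<beta>(1) PiE_ext[of \<beta> "{1..n}" "\<lambda>_. UNIV" \<gamma>] by auto
      then have "N \<gamma> = mat_zero" by (simp only: N0[OF True] of_bool_eq mat_scale_simps)
      then show ?thesis using filtration_closed by (simp add: lin_closed_def)
    next
      case False
      then have "basis_unit \<gamma> \<in> filtration 1" by (intro basis_unit_in_filtration) simp
      then have "mat_mul Y s (basis_unit \<gamma>) \<in> filtration 1" using filtration_mul[OF s] by fastforce
      then show ?thesis unfolding N_def using filtration_mul[OF _ bu] by fastforce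
    qed
    then have R: "R \<in> filtration 1"
      unfolding R_def using finK by (intro lin_closed_sum[OF filtration_closed]) auto
    have "mat_mul Y (mat_mul Y s M) ?t = (\<lambda>y z. \<Sum>\<gamma>\<in>?K. c \<gamma> * N \<gamma> y z)"
      unfolding Mc N_def by (simp only: mat_mul_sum)
    also have "\<dots> = mat_add (mat_scale (c \<beta>) (N \<beta>)) R"
      unfolding R_def mat_add_def mat_scale_def using finK \<beta>(1) by (intro ext) (rule sum.remove)
    also have "mat_scale (c \<beta>) (N \<beta>) = ?e" using \<beta>(2) by (simp add: N\<beta> mat_scale_simps)
    finally have "mat_mul Y (mat_mul Y s M) ?t = mat_add ?e R" .
    then have "?e = \<zero>\<^bsub>TA\<^esub>"
      using TA.idempotent_in_radical_mod_nilpotent[OF M _ _ nilpotent_ideal_filtration R, of s ?t ?e]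
        s bu basis_unit_core_idem by simp
    then have "?e = mat_zero" by simp
    then have "basis_unit \<beta> = mat_zero"
      using basis_unit_recover[of \<beta>] by (simp add: mat_mul_linear)
    then show ?thesis using filtration_closed by (simp add: lin_closed_def)
  qed
  then show "M \<in> filtration 1"
    unfolding Mc by (intro lin_closed_sum[OF filtration_closed finK])
qed

end

theorem theorem6p9:
  fixes n :: nat and U :: "nat \<Rightarrow> 'u set" and x :: "nat \<Rightarrow> 'u"
    and T :: "('f::field, (nat \<Rightarrow> 'u) \<Rightarrow> (nat \<Rightarrow> 'u) \<Rightarrow> 'f) module"
  assumes "n \<ge> 1"
    and "\<And>h. h \<in> {1..n} \<Longrightarrow> finite (U h) \<and> card (U h) \<ge> 2"
    and "x \<in> points n U"
    and "T = terwilliger_algebra n U x"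
  shows "jacobson_radical T \<subseteq> radical_span n U x
    \<and> jacobson_radical T = radical_span n U x
    \<and> nilpotent_ideal (jacobson_radical T) T
    \<and> nilpotent_index (jacobson_radical T) T =
        2 * card {a \<in> {1..n}. of_nat (card (U a) - 1) = (0::'f)} + 1"
proof -
  interpret factorial_scheme n U x "TYPE('f)"
    by unfold_locales (use assms in auto)
  have T: "T = TA" using assms(4) by (simp only: terwilliger_algebra_eq)
  have J: "jacobson_radical T = filtration 1"
    unfolding T using jacobson_radical_le_filtration
      TA.nilpotent_ideal_le_jacobson_radical[OF nilpotent_ideal_filtration] by (rule subset_antisym)
  show ?thesis
    unfolding J unfolding T radical_span_eq
    using nilpotent_ideal_filtration nilpotent_index_filtration by (simp add: bad_def)
qed

end
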